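(* Let $R_1$ and $R_2$ be two nc rational expressions in $x_1,\dots,x_d$ over a field $\mathbb K$ which admit nc Fornasini--Marchesini realizations $\mathcal R_1$ and $\mathcal R_2$, respectively, both centred at $\underline Y\in(\mathbb K^{s\times s})^d$, described by $(L_1,D^1,C^1,\underline{\mathbf A}^1,\underline{\mathbf B}^1)$ and $(L_2,D^2,C^2,\underline{\mathbf A}^2,\underline{\mathbf B}^2)$. Assume that both $\mathcal R_1$ and $\mathcal R_2$ are controllable and observable. If $R_1$ and $R_2$ are $(\mathbb K^d)_{nc}$-evaluation equivalent, then $\mathcal R_1$ and $\mathcal R_2$ are uniquely similar, i.e., $L_1=L_2$, $D^1=D^2$ and there exists a unique invertible matrix $T\in\mathbb K^{L_1\times L_1}$ such that $$C^2=C^1T^{-1},\qquad \mathbf B^2_k=T\cdot\mathbf B^1_k,\qquad \mathbf A^2_k=T\cdot\mathbf A^1_k\cdot T^{-1},\qquad 1\le k\le d.$$ Moreover, for every $m\in\mathbb N$, $DOM_{sm}(\mathcal R_1)=DOM_{sm}(\mathcal R_2)$ and $\mathcal R_1(\underline X)=\mathcal R_2(\underline X)$ for all $\underline X\in DOM_{sm}(\mathcal R_1)$; and for every unital $\mathbb K$-algebra $\mathcal A$, $DOM^{\mathcal A}(\mathcal R_1)=DOM^{\mathcal A}(\mathcal R_2)$ and $\mathcal R_1^{\mathcal A}(\underline{\mathfrak A})=\mathcal R_2^{\mathcal A}(\underline{\mathfrak A})$ for all $\underline{\mathfrak A}\in DOM^{\mathcal A}(\mathcal R_1)$.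
   Context: $\mathbb K$ is a field, $\mathbb N=\{1,2,\dots\}$, $d\in\mathbb N$; underlined letters denote tuples; $\otimes$ is the Kronecker product. NC rational expressions. A nc rational expression $R$ in $x_1,\dots,x_d$ over $\mathbb K$ is a formal expression obtained from nc polynomials in $\mathbb K\langle x_1,\dots,x_d\rangle$ by successive additions, multiplications and inversions. $dom_n(R)\subseteq(\mathbb K^{n\times n})^d$ is the set of $d$-tuples of $n\times n$ matrices at which all inverses occurring in $R$ exist (evaluating recursively), $R(\underline X)\in\mathbb K^{n\times n}$ is the resulting value, and $dom(R)=\coprod_{n\ge1}dom_n(R)$. $R_1,R_2$ are $(\mathbb K^d)_{nc}$-evaluation equivalent if $R_1(\underline X)=R_2(\underline X)$ for all $\underline X\in dom(R_1)\cap dom(R_2)$. Realizations. Let $\underline Y\in(\mathbb K^{s\times s})^d$. A nc Fornasini--Marchesini realization $\mathcal R$ centred at $\underline Y$, described by $(L,D,C,\underline{\mathbf A},\underline{\mathbf B})$ with $L\in\mathbb N$, consists of linear mappings $\mathbf A_1,\dots,\mathbf A_d:\mathbb K^{s\times s}\to\mathbb K^{L\times L}$, $\mathbf B_1,\dots,\mathbf B_d:\mathbb K^{s\times s}\to\mathbb K^{L\times s}$ and matrices $C\in\mathbb K^{s\times L}$, $D\in\mathbb K^{s\times s}$. Products of operators with constant matrices are pointwise: $(T\cdot\mathbf A_k\cdot T^{-1})(X)=T\mathbf A_k(X)T^{-1}$. A linear mapping $\mathbf T$ on $s\times s$ matrices is extended to $X=[X_{ij}]_{i,j=1}^m\in\mathbb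 K^{sm\times sm}$ ($X_{ij}\in\mathbb K^{s\times s}$) by $(X)\mathbf T=[\mathbf T(X_{ij})]_{i,j=1}^m$. Put $DOM_{sm}(\mathcal R)=\{\underline X\in(\mathbb K^{sm\times sm})^d:\det(I_{Lm}-\sum_{k=1}^d(X_k-I_m\otimes Y_k)\mathbf A_k)\ne0\}$ and for such $\underline X$ $$\mathcal R(\underline X)=I_m\otimes D+(I_m\otimes C)\Big(I_{Lm}-\sum_{k=1}^d(X_k-I_m\otimes Y_k)\mathbf A_k\Big)^{-1}\sum_{k=1}^d(X_k-I_m\otimes Y_k)\mathbf B_k.$$ For a unital $\mathbb K$-algebra $\mathcal A$, identify $\mathcal A^{p\times q}=\mathbb K^{p\times q}\otimes\mathcal A$ and extend $\mathbf T$ by $(\mathfrak A)\mathbf T^{\mathcal A}=\sum_{i,j}\mathbf T(E_{ij})\otimes\mathfrak a_{ij}$ for $\mathfrak A=\sum_{i,j} E_{ij}\otimes\mathfrak a_{ij}$. $DOM^{\mathcal A}(\mathcal R)$ is the set of $\underline{\mathfrak A}\in(\mathcal A^{s\times s})^d$ for which $I_L\otimes1_{\mathcal A}-\sum_k(\mathfrak A_k-Y_k\otimes1_{\mathcal A})\mathbf A_k^{\mathcal A}$ is invertible in $\mathcal A^{L\times L}$, and then $$\mathcal R^{\mathcal A}(\underline{\mathfrak A})=D\otimes1_{\mathcal A}+(C\otimes1_{\mathcal A})\Big(I_L\otimes1_{\mathcal A}-\sum_k(\mathfrak A_k-Y_k\otimes1_{\mathcal A})\mathbf A_k^{\mathcal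 A}\Big)^{-1}\sum_k(\mathfrak A_k-Y_k\otimes1_{\mathcal A})\mathbf B_k^{\mathcal A}.$$ $R$ admits the realization $\mathcal R$ centred at $\underline Y$ if $\underline Y\in dom_s(R)$ and for every $m\in\mathbb N$: $dom_{sm}(R)\subseteq DOM_{sm}(\mathcal R)$ and $R(\underline X)=\mathcal R(\underline X)$ for all $\underline X\in dom_{sm}(R)$. $\mathcal R$ is controllable if the vectors $\mathbf A_{i_1}(X_1)\cdots\mathbf A_{i_\ell}(X_\ell)\mathbf B_k(X_{\ell+1})u$ ($\ell\ge0$, $1\le i_1,\dots,i_\ell,k\le d$, $X_j\in\mathbb K^{s\times s}$, $u\in\mathbb K^s$) span $\mathbb K^L$; observable if the only $v\in\mathbb K^L$ with $C\mathbf A_{i_1}(X_1)\cdots\mathbf A_{i_\ell}(X_\ell)v=0$ for all $\ell\ge0$, $1\le i_j\le d$, $X_j\in\mathbb K^{s\times s}$ is $v=0$. *)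

theory Defs
  imports
    "Jordan_Normal_Form.Determinant"
    "Jordan_Normal_Form.VS_Connect"
    "HOL-Library.Poly_Mapping"
begin

text \<open>
  Conventions. The index type \<open>'d\<close> of class \<open>finite\<close> indexes the noncommuting variables, so
  \<open>d = CARD('d)\<close> and a \<open>d\<close>-tuple of matrices is a function \<open>'d \<Rightarrow> 'k mat\<close>. Sizes are ordinary
  natural numbers. A linear mapping between matrix spaces is a function on the type of all matrices;
  only its values on the matrices of the appropriate size are ever used.
\<close>

section \<open>Matrices\<close>

text \<open>
  The type of all matrices has no zero, so finite sums carry the size of the result.
\<close>

definition mat_sum :: "nat \<Rightarrow> nat \<Rightarrow> ('i \<Rightarrow> 'a::comm_monoid_add mat) \<Rightarrow> 'i set \<Rightarrow> 'a mat" where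
  "mat_sum r c f S = mat r c (\<lambda>(i, j). \<Sum>k\<in>S. f k $$ (i, j))"

definition kron :: "'a::times mat \<Rightarrow> 'a mat \<Rightarrow> 'a mat" where
  "kron P Q = mat (dim_row P * dim_row Q) (dim_col P * dim_col Q)
     (\<lambda>(i, j). P $$ (i div dim_row Q, j div dim_col Q) * Q $$ (i mod dim_row Q, j mod dim_col Q))"

text \<open>
  The predicate \<^const>\<open>invertible_mat\<close> is restricted to the class \<^class>\<open>semiring_1\<close>, which
  demands \<open>0 \<noteq> 1\<close>. The following notions do not, so that they also apply over the zero algebra;
  the two lemmas below show that they agree with those of the library otherwise.
\<close>

definition is_mat_inverse :: "'a::{semiring_0, one} mat \<Rightarrow> 'a mat \<Rightarrow> bool" where
  "is_mat_inverse P Q \<longleftrightarrow> (\<exists>n. P \<in> carrier_mat n n \<and> Q \<in> carrier_mat n n \<and>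
     P * Q = 1\<^sub>m n \<and> Q * P = 1\<^sub>m n)"

definition mat_inv :: "'a::{semiring_0, one} mat \<Rightarrow> 'a mat" where
  "mat_inv P = (THE Q. is_mat_inverse P Q)"

lemma invertible_mat_iff_is_mat_inverse:
  fixes P :: "'a::semiring_1 mat"
  shows "invertible_mat P \<longleftrightarrow> (\<exists>Q. is_mat_inverse P Q)"
proof
  assume "invertible_mat P"
  then obtain Q where sq: "dim_row P = dim_col P"
    and PQ: "P * Q = 1\<^sub>m (dim_row P)" and QP: "Q * P = 1\<^sub>m (dim_row Q)"
    by (auto simp: invertible_mat_def inverts_mat_def)
  have "dim_col Q = dim_row P" using arg_cong[OF PQ, of dim_col] by simp
  moreover have "dim_row Q = dim_col P" using arg_cong[OF QP, of dim_col] by simp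
  ultimately show "\<exists>Q. is_mat_inverse P Q"
    using sq PQ QP unfolding is_mat_inverse_def
    by (intro exI[of _ Q] exI[of _ "dim_row P"]) auto
qed (auto simp: is_mat_inverse_def invertible_mat_def inverts_mat_def)

lemma mat_inv_eqI:
  fixes P :: "'a::{semiring_0, monoid_mult} mat"
  assumes "is_mat_inverse P Q"
  shows "mat_inv P = Q"
proof -
  have one_l: "1\<^sub>m n * A = A" if "A \<in> carrier_mat n n" for n and A :: "'a mat"
  proof (rule eq_matI)
    fix i j assume "i < dim_row A" "j < dim_col A"
    then have "(1\<^sub>m n * A) $$ (i, j) = (\<Sum>k\<in>{0..<n}. (if i = k then 1 else 0) * A $$ (k, j))"
      using that by (auto simp: scalar_prod_def)
    also have "\<dots> = (\<Sum>k\<in>{0..<n}. if k = i then A $$ (k, j) else 0)"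
      by (rule sum.cong) auto
    finally show "(1\<^sub>m n * A) $$ (i, j) = A $$ (i, j)"
      using \<open>i < dim_row A\<close> that by simp
  qed (use that in auto)
  have one_r: "A * 1\<^sub>m n = A" if "A \<in> carrier_mat n n" for n and A :: "'a mat"
  proof (rule eq_matI)
    fix i j assume "i < dim_row A" "j < dim_col A"
    then have "(A * 1\<^sub>m n) $$ (i, j) = (\<Sum>k\<in>{0..<n}. A $$ (i, k) * (if k = j then 1 else 0))"
      using that by (auto simp: scalar_prod_def)
    also have "\<dots> = (\<Sum>k\<in>{0..<n}. if k = j then A $$ (i, k) else 0)"
      by (rule sum.cong) auto
    finally show "(A * 1\<^sub>m n) $$ (i, j) = A $$ (i, j)"
      using \<open>j < dim_col A\<close> that by simp
  qed (use that in auto)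
  have "Q' = Q" if "is_mat_inverse P Q'" for Q'
  proof -
    obtain n where n: "P \<in> carrier_mat n n" "Q \<in> carrier_mat n n" "P * Q = 1\<^sub>m n"
      using assms unfolding is_mat_inverse_def by blast
    with that have n': "Q' \<in> carrier_mat n n" "Q' * P = 1\<^sub>m n"
      unfolding is_mat_inverse_def by auto
    have "Q' = Q' * (P * Q)" using n n' one_r by simp
    also have "\<dots> = (Q' * P) * Q" by (rule assoc_mult_mat[symmetric]) (use n n' in auto)
    also have "\<dots> = Q" using n n' one_l by simp
    finally show ?thesis .
  qed
  with assms show ?thesis unfolding mat_inv_def by blast
qed

definition linear_mat_map ::
    "nat \<Rightarrow> nat \<Rightarrow> nat \<Rightarrow> nat \<Rightarrow> ('k::field mat \<Rightarrow> 'k mat) \<Rightarrow> bool" where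
  "linear_mat_map r c p q T \<longleftrightarrow>
     (\<forall>X\<in>carrier_mat r c. T X \<in> carrier_mat p q) \<and>
     (\<forall>X\<in>carrier_mat r c. \<forall>Y\<in>carrier_mat r c. T (X + Y) = T X + T Y) \<and>
     (\<forall>a. \<forall>X\<in>carrier_mat r c. T (a \<cdot>\<^sub>m X) = a \<cdot>\<^sub>m T X)"

section \<open>Noncommutative rational expressions\<close>

text \<open>
  A noncommutative polynomial is a finitely supported function on words, and an expression is
  purely syntactic: no identification is made and no inversion is excluded.
\<close>

type_synonym ('d, 'k) nc_poly = "'d list \<Rightarrow>\<^sub>0 'k"

context notes [[typedef_overloaded]]
begin

datatype ('d, 'k::zero) nc_rat =
    NCPoly "('d, 'k) nc_poly"
  | NCAdd "('d, 'k) nc_rat" "('d, 'k) nc_rat"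
  | NCMult "('d, 'k) nc_rat" "('d, 'k) nc_rat"
  | NCInv "('d, 'k) nc_rat"

end

definition nc_poly_eval :: "nat \<Rightarrow> ('d \<Rightarrow> 'k::field mat) \<Rightarrow> ('d, 'k) nc_poly \<Rightarrow> 'k mat" where
  "nc_poly_eval n X p = mat_sum n n
     (\<lambda>w. Poly_Mapping.lookup p w \<cdot>\<^sub>m foldr (\<lambda>i M. X i * M) w (1\<^sub>m n)) (Poly_Mapping.keys p)"

primrec nc_eval :: "nat \<Rightarrow> ('d \<Rightarrow> 'k::field mat) \<Rightarrow> ('d, 'k) nc_rat \<Rightarrow> 'k mat" where
  "nc_eval n X (NCPoly p) = nc_poly_eval n X p"
| "nc_eval n X (NCAdd R S) = nc_eval n X R + nc_eval n X S"
| "nc_eval n X (NCMult R S) = nc_eval n X R * nc_eval n X S"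
| "nc_eval n X (NCInv R) = mat_inv (nc_eval n X R)"

primrec nc_defined :: "nat \<Rightarrow> ('d \<Rightarrow> 'k::field mat) \<Rightarrow> ('d, 'k) nc_rat \<Rightarrow> bool" where
  "nc_defined n X (NCPoly p) \<longleftrightarrow> True"
| "nc_defined n X (NCAdd R S) \<longleftrightarrow> nc_defined n X R \<and> nc_defined n X S"
| "nc_defined n X (NCMult R S) \<longleftrightarrow> nc_defined n X R \<and> nc_defined n X S"
| "nc_defined n X (NCInv R) \<longleftrightarrow> nc_defined n X R \<and> invertible_mat (nc_eval n X R)"

definition nc_dom :: "nat \<Rightarrow> ('d, 'k::field) nc_rat \<Rightarrow> ('d \<Rightarrow> 'k mat) set" where
  "nc_dom n R = {X. (\<forall>k. X k \<in> carrier_mat n n) \<and> nc_defined n X R}"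

definition nc_eval_equiv :: "('d, 'k::field) nc_rat \<Rightarrow> ('d, 'k) nc_rat \<Rightarrow> bool" where
  "nc_eval_equiv R S \<longleftrightarrow>
     (\<forall>n\<ge>1. \<forall>X\<in>nc_dom n R \<inter> nc_dom n S. nc_eval n X R = nc_eval n X S)"

section \<open>Fornasini--Marchesini realizations\<close>

record ('d, 'k) fm =
  fm_L :: nat
  fm_D :: "'k mat"
  fm_C :: "'k mat"
  fm_A :: "'d \<Rightarrow> 'k mat \<Rightarrow> 'k mat"
  fm_B :: "'d \<Rightarrow> 'k mat \<Rightarrow> 'k mat"

definition fm_realization :: "nat \<Rightarrow> ('d, 'k::field) fm \<Rightarrow> bool" where
  "fm_realization s F \<longleftrightarrow>
     fm_L F \<ge> 1 \<and>
     fm_D F \<in> carrier_mat s s \<and>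
     fm_C F \<in> carrier_mat s (fm_L F) \<and>
     (\<forall>k. linear_mat_map s s (fm_L F) (fm_L F) (fm_A F k)) \<and>
     (\<forall>k. linear_mat_map s s (fm_L F) s (fm_B F k))"

text \<open>
  \<open>block s X i j\<close> is the \<open>(i, j)\<close> block of \<open>X\<close> with respect to blocks of size \<open>s \<times> s\<close>, and
  \<open>blockwise s m p q T X\<close> is \<open>(X)T\<close> for \<open>X\<close> of size \<open>sm \<times> sm\<close> and \<open>T\<close> with values of size \<open>p \<times> q\<close>.
\<close>

definition block :: "nat \<Rightarrow> 'k mat \<Rightarrow> nat \<Rightarrow> nat \<Rightarrow> 'k mat" where
  "block s X i j = mat s s (\<lambda>(a, b). X $$ (i * s + a, j * s + b))"

definition blockwise ::
    "nat \<Rightarrow> nat \<Rightarrow> nat \<Rightarrow> nat \<Rightarrow> ('k mat \<Rightarrow> 'k mat) \<Rightarrow> 'k mat \<Rightarrow> 'k mat" where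
  "blockwise s m p q T X =
     mat (p * m) (q * m) (\<lambda>(a, b). T (block s X (a div p) (b div q)) $$ (a mod p, b mod q))"

definition fm_pencil ::
    "nat \<Rightarrow> ('d::finite \<Rightarrow> 'k::field mat) \<Rightarrow> ('d, 'k) fm \<Rightarrow> nat \<Rightarrow> ('d \<Rightarrow> 'k mat) \<Rightarrow> 'k mat" where
  "fm_pencil s Y F m X = 1\<^sub>m (fm_L F * m) - mat_sum (fm_L F * m) (fm_L F * m)
     (\<lambda>k. blockwise s m (fm_L F) (fm_L F) (fm_A F k) (X k - kron (1\<^sub>m m) (Y k))) UNIV"

definition fm_DOM ::
    "nat \<Rightarrow> ('d::finite \<Rightarrow> 'k::field mat) \<Rightarrow> ('d, 'k) fm \<Rightarrow> nat \<Rightarrow> ('d \<Rightarrow> 'k mat) set" where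
  "fm_DOM s Y F m =
     {X. (\<forall>k. X k \<in> carrier_mat (s * m) (s * m)) \<and> det (fm_pencil s Y F m X) \<noteq> 0}"

definition fm_eval ::
    "nat \<Rightarrow> ('d::finite \<Rightarrow> 'k::field mat) \<Rightarrow> ('d, 'k) fm \<Rightarrow> nat \<Rightarrow> ('d \<Rightarrow> 'k mat) \<Rightarrow> 'k mat" where
  "fm_eval s Y F m X = kron (1\<^sub>m m) (fm_D F) +
     kron (1\<^sub>m m) (fm_C F) * mat_inv (fm_pencil s Y F m X) *
     mat_sum (fm_L F * m) (s * m)
       (\<lambda>k. blockwise s m (fm_L F) s (fm_B F k) (X k - kron (1\<^sub>m m) (Y k))) UNIV"

definition admits_realization ::
    "('d::finite, 'k::field) nc_rat \<Rightarrow> nat \<Rightarrow> ('d \<Rightarrow> 'k mat) \<Rightarrow> ('d, 'k) fm \<Rightarrow> bool" where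
  "admits_realization R s Y F \<longleftrightarrow> Y \<in> nc_dom s R \<and>
     (\<forall>m\<ge>1. nc_dom (s * m) R \<subseteq> fm_DOM s Y F m \<and>
       (\<forall>X\<in>nc_dom (s * m) R. nc_eval (s * m) X R = fm_eval s Y F m X))"

subsection \<open>Evaluation over a unital algebra\<close>

text \<open>
  The class \<^class>\<open>ring_1\<close> would exclude the zero algebra, the sort used here does not.
\<close>

locale unital_algebra = vector_space scale
  for scale :: "'k::field \<Rightarrow> 'a::{ring, monoid_mult} \<Rightarrow> 'a" +
  assumes scale_mult_left: "scale c x * y = scale c (x * y)"
    and scale_mult_right: "x * scale c y = scale c (x * y)"

definition mat_tensor :: "('k \<Rightarrow> 'a \<Rightarrow> 'a) \<Rightarrow> 'k mat \<Rightarrow> 'a \<Rightarrow> 'a mat" where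
  "mat_tensor scale P a = map_mat (\<lambda>c. scale c a) P"

definition elem_mat :: "nat \<Rightarrow> nat \<Rightarrow> nat \<Rightarrow> 'k::{zero, one} mat" where
  "elem_mat s i j = mat s s (\<lambda>(a, b). if a = i \<and> b = j then 1 else 0)"

definition alg_extend ::
    "('k::field \<Rightarrow> 'a::{ring, monoid_mult} \<Rightarrow> 'a) \<Rightarrow> nat \<Rightarrow> nat \<Rightarrow> nat \<Rightarrow>
      ('k mat \<Rightarrow> 'k mat) \<Rightarrow> 'a mat \<Rightarrow> 'a mat" where
  "alg_extend scale s p q T Z = mat_sum p q
     (\<lambda>(i, j). mat_tensor scale (T (elem_mat s i j)) (Z $$ (i, j))) ({..<s} \<times> {..<s})"

definition fm_alg_pencil ::
    "('k::field \<Rightarrow> 'a::{ring, monoid_mult} \<Rightarrow> 'a) \<Rightarrow> nat \<Rightarrow> ('d::finite \<Rightarrow> 'k mat) \<Rightarrow> ('d, 'k) fm \<Rightarrow>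
      ('d \<Rightarrow> 'a mat) \<Rightarrow> 'a mat" where
  "fm_alg_pencil scale s Y F Z =
     mat_tensor scale (1\<^sub>m (fm_L F)) 1 - mat_sum (fm_L F) (fm_L F)
       (\<lambda>k. alg_extend scale s (fm_L F) (fm_L F) (fm_A F k) (Z k - mat_tensor scale (Y k) 1)) UNIV"

definition fm_alg_DOM ::
    "('k::field \<Rightarrow> 'a::{ring, monoid_mult} \<Rightarrow> 'a) \<Rightarrow> nat \<Rightarrow> ('d::finite \<Rightarrow> 'k mat) \<Rightarrow> ('d, 'k) fm \<Rightarrow>
      ('d \<Rightarrow> 'a mat) set" where
  "fm_alg_DOM scale s Y F =
     {Z. (\<forall>k. Z k \<in> carrier_mat s s) \<and> (\<exists>Q. is_mat_inverse (fm_alg_pencil scale s Y F Z) Q)}"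

definition fm_alg_eval ::
    "('k::field \<Rightarrow> 'a::{ring, monoid_mult} \<Rightarrow> 'a) \<Rightarrow> nat \<Rightarrow> ('d::finite \<Rightarrow> 'k mat) \<Rightarrow> ('d, 'k) fm \<Rightarrow>
      ('d \<Rightarrow> 'a mat) \<Rightarrow> 'a mat" where
  "fm_alg_eval scale s Y F Z = mat_tensor scale (fm_D F) 1 +
     mat_tensor scale (fm_C F) 1 * mat_inv (fm_alg_pencil scale s Y F Z) *
     mat_sum (fm_L F) s
       (\<lambda>k. alg_extend scale s (fm_L F) s (fm_B F k) (Z k - mat_tensor scale (Y k) 1)) UNIV"

subsection \<open>Controllability and observability\<close>

text \<open>
  The word \<open>[(i\<^sub>1, X\<^sub>1), \<dots>, (i\<^sub>l, X\<^sub>l)]\<close> encodes the product \<open>A\<^sub>i\<^sub>1(X\<^sub>1) \<cdots> A\<^sub>i\<^sub>l(X\<^sub>l)\<close>.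
\<close>

definition fm_word :: "('d, 'k::field) fm \<Rightarrow> ('d \<times> 'k mat) list \<Rightarrow> 'k mat" where
  "fm_word F w = foldr (\<lambda>(i, X) M. fm_A F i X * M) w (1\<^sub>m (fm_L F))"

definition fm_controllable :: "nat \<Rightarrow> ('d, 'k::field) fm \<Rightarrow> bool" where
  "fm_controllable s F \<longleftrightarrow>
     LinearCombinations.module.span class_ring (module_vec TYPE('k) (fm_L F))
       {(fm_word F w * fm_B F k X) *\<^sub>v u | w k X u.
          snd ` set w \<subseteq> carrier_mat s s \<and> X \<in> carrier_mat s s \<and> u \<in> carrier_vec s}
     = carrier_vec (fm_L F)"

definition fm_observable :: "nat \<Rightarrow> ('d, 'k::field) fm \<Rightarrow> bool" where
  "fm_observable s F \<longleftrightarrow>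
     (\<forall>v\<in>carrier_vec (fm_L F).
        (\<forall>w. snd ` set w \<subseteq> carrier_mat s s \<longrightarrow> (fm_C F * fm_word F w) *\<^sub>v v = 0\<^sub>v s) \<longrightarrow>
        v = 0\<^sub>v (fm_L F))"

subsection \<open>Similarity\<close>

definition fm_similarity :: "nat \<Rightarrow> ('d, 'k::field) fm \<Rightarrow> ('d, 'k) fm \<Rightarrow> 'k mat \<Rightarrow> bool" where
  "fm_similarity s F G T \<longleftrightarrow>
     T \<in> carrier_mat (fm_L F) (fm_L F) \<and> invertible_mat T \<and>
     fm_C G = fm_C F * mat_inv T \<and>
     (\<forall>k. \<forall>X\<in>carrier_mat s s. fm_B G k X = T * fm_B F k X) \<and>
     (\<forall>k. \<forall>X\<in>carrier_mat s s. fm_A G k X = T * fm_A F k X * mat_inv T)"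

definition uniquely_similar :: "nat \<Rightarrow> ('d, 'k::field) fm \<Rightarrow> ('d, 'k) fm \<Rightarrow> bool" where
  "uniquely_similar s F G \<longleftrightarrow>
     fm_L F = fm_L G \<and> fm_D F = fm_D G \<and> (\<exists>!T. fm_similarity s F G T)"

end

(*
  Evaluate both expressions at points X whose only nonzero blocks are Y on the diagonal and arbitrary
  matrices just above it. An expression defined at Y is defined at all block upper triangular points
  with diagonal Y, because an inverse of a block triangular matrix only needs the diagonal blocks to
  be invertible. There I - sum (X - I (x) Y) A is I minus a nilpotent matrix, and comparing the values
  block by block shows D1 = D2 and C1 A1 ... A1 B1 = C2 A2 ... A2 B2 for all words. Over a finite field
  this works as well, since no polynomial identity principle is used.

  The pairs (A1 ... A1 B1 u, A2 ... A2 B2 u) span a subspace of K^L1 x K^L2. Controllability makes it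
  total on both sides; equality of the words above and observability make it single-valued in both
  directions. Hence it is the graph of an isomorphism T, which is the similarity, and every similarity
  has this graph. Finally the pencils of similar realizations are conjugate by I (x) T, respectively
  T (x) 1, which gives equal domains and values.
*)
theory Submission imports Defs begin

section \<open>Matrices\<close>

text \<open>The obstacle is that both expressions must be defined at one and the same test point.
  Nothing is known about the two domains beyond \<open>Y\<close>, so only points that are block
  triangular over \<open>Y\<close> are certain to lie in both; their blocks above the diagonal are
  free, which is just enough to isolate every single word. The inverse of the pencil
  \<open>P\<close> at such a point is not computed. A candidate \<open>W\<close> is written down,
  \<open>P * W = B\<close> is checked, and invertibility of \<open>P\<close>, which is part of
  \<open>admits_realization\<close>, identifies \<open>W\<close> with the inverse of
  \<open>P\<close> times \<open>B\<close>. Working with a relation between the state spaces avoids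
  choosing a basis among the reachable vectors and proving a map on their span well defined.
  Equality of the dimensions comes last, from two mutually inverse matrices that are a priori
  rectangular. In the algebra \<open>0 = 1\<close> is possible, hence the sort
  \<open>{semiring_0, monoid_mult}\<close> below; the same conjugation lemmas then serve matrix
  points and algebra points.\<close>

lemma one_mult_mat_left:
  fixes A :: "'a::{semiring_0, monoid_mult} mat"
  assumes "A \<in> carrier_mat n m"
  shows "1\<^sub>m n * A = A"
proof (rule eq_matI)
  fix i j assume "i < dim_row A" "j < dim_col A"
  then have "(1\<^sub>m n * A) $$ (i, j) = (\<Sum>k\<in>{0..<n}. (if i = k then 1 else 0) * A $$ (k, j))"
    using assms by (auto simp: scalar_prod_def)
  also have "\<dots> = (\<Sum>k\<in>{0..<n}. if k = i then A $$ (k, j) else 0)"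
    by (rule sum.cong) auto
  finally show "(1\<^sub>m n * A) $$ (i, j) = A $$ (i, j)"
    using \<open>i < dim_row A\<close> assms by simp
qed (use assms in auto)

lemma mult_one_mat_right:
  fixes A :: "'a::{semiring_0, monoid_mult} mat"
  assumes "A \<in> carrier_mat n m"
  shows "A * 1\<^sub>m m = A"
proof (rule eq_matI)
  fix i j assume "i < dim_row A" "j < dim_col A"
  then have "(A * 1\<^sub>m m) $$ (i, j) = (\<Sum>k\<in>{0..<m}. A $$ (i, k) * (if k = j then 1 else 0))"
    using assms by (auto simp: scalar_prod_def)
  also have "\<dots> = (\<Sum>k\<in>{0..<m}. if k = j then A $$ (i, k) else 0)"
    by (rule sum.cong) auto
  finally show "(A * 1\<^sub>m m) $$ (i, j) = A $$ (i, j)"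
    using \<open>j < dim_col A\<close> assms by simp
qed (use assms in auto)

lemma index_mult_mat_sum:
  assumes "A \<in> carrier_mat p q" "B \<in> carrier_mat q r" "i < p" "j < r"
  shows "(A * B) $$ (i, j) = (\<Sum>c<q. A $$ (i, c) * B $$ (c, j))"
  using assms by (auto simp: scalar_prod_def atLeast0LessThan)

text \<open>The one cancellation behind the conjugation identities for inverses, transfer
  expressions and similarities.\<close>

lemma mult_cancel_mid_mat:
  fixes A :: "'a::{semiring_0, monoid_mult} mat"
  assumes "A \<in> carrier_mat p n" "T' \<in> carrier_mat n n" "T \<in> carrier_mat n n" "B \<in> carrier_mat n q"
    and "T' * T = 1\<^sub>m n"
  shows "A * T' * (T * B) = A * B"
proof -
  have "A * T' * (T * B) = A * (T' * (T * B))"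
    using assms by (intro assoc_mult_mat) auto
  also have "T' * (T * B) = (T' * T) * B"
    using assms by (intro assoc_mult_mat[symmetric]) auto
  also have "\<dots> = B" using assms by (simp add: one_mult_mat_left)
  finally show ?thesis .
qed

lemma is_mat_inverse_conj:
  fixes P :: "'a::{semiring_0, monoid_mult} mat"
  assumes P: "P \<in> carrier_mat n n" and T: "T \<in> carrier_mat n n" "T' \<in> carrier_mat n n"
    and TT': "T * T' = 1\<^sub>m n" "T' * T = 1\<^sub>m n"
    and PQ: "is_mat_inverse P Q"
  shows "is_mat_inverse (T * P * T') (T * Q * T')"
proof -
  have Q: "Q \<in> carrier_mat n n" "P * Q = 1\<^sub>m n" "Q * P = 1\<^sub>m n"
    using PQ P by (auto simp: is_mat_inverse_def)
  \<comment> \<open>Stated for arbitrary \<open>M\<close> and \<open>N\<close>, so that it covers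
    both orders, \<open>P * Q\<close> and \<open>Q * P\<close>.\<close>
  have *: "T * M * T' * (T * N * T') = 1\<^sub>m n"
    if "M \<in> carrier_mat n n" "N \<in> carrier_mat n n" "M * N = 1\<^sub>m n" for M N
  proof -
    have "T * M * T' * (T * N * T') = T * M * T' * (T * (N * T'))"
      using that T by (subst assoc_mult_mat[of T n n N n T' n]) auto
    also have "\<dots> = T * M * (N * T')"
      using that T TT' by (intro mult_cancel_mid_mat[of _ n n]) auto
    also have "\<dots> = T * T'"
      using that T by (intro mult_cancel_mid_mat[of _ n n]) auto
    finally show ?thesis using TT' by simp
  qed
  show ?thesis unfolding is_mat_inverse_def
    by (rule exI[of _ n]) (use P T Q * in auto)
qed

text \<open>The converse direction conjugates back with \<open>T'\<close> and \<open>T\<close>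
  exchanged, which recovers \<open>P\<close>.\<close>

lemma mat_inverse_conj_iff:
  fixes P :: "'a::{semiring_0, monoid_mult} mat"
  assumes P: "P \<in> carrier_mat n n" and T: "T \<in> carrier_mat n n" "T' \<in> carrier_mat n n"
    and TT': "T * T' = 1\<^sub>m n" "T' * T = 1\<^sub>m n"
  shows "(\<exists>Q. is_mat_inverse (T * P * T') Q) \<longleftrightarrow> (\<exists>Q. is_mat_inverse P Q)"
proof
  assume "\<exists>Q. is_mat_inverse (T * P * T') Q"
  then obtain Q where "is_mat_inverse (T * P * T') Q" ..
  then have "is_mat_inverse (T' * (T * P * T') * T) (T' * Q * T)"
    using assms by (intro is_mat_inverse_conj[of _ n]) auto
  moreover have "T' * (T * P * T') * T = P"
  proof -
    \<comment> \<open>The identity factors are inserted only to give the products the shape that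
      \<open>mult_cancel_mid_mat\<close> expects.\<close>
    have "T' * (T * P * T') * T = T' * ((T * P) * T' * (T * 1\<^sub>m n))"
      using assms by (simp add: mult_one_mat_right assoc_mult_mat[where n\<^sub>1=n and n\<^sub>2=n and n\<^sub>3=n and n\<^sub>4=n])
    also have "(T * P) * T' * (T * 1\<^sub>m n) = T * P"
      using assms by (subst mult_cancel_mid_mat[of _ n n]) (auto simp: mult_one_mat_right[of _ n])
    also have "T' * (T * P) = 1\<^sub>m n * T' * (T * P)"
      using assms by (simp add: one_mult_mat_left)
    also have "\<dots> = P"
      using assms by (subst mult_cancel_mid_mat[of _ n n]) (auto simp: one_mult_mat_left[of _ n])
    finally show ?thesis .
  qed
  ultimately show "\<exists>Q. is_mat_inverse P Q" by auto
qed (use assms is_mat_inverse_conj in blast)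

text \<open>A change of state coordinates leaves the transfer expression alone, because
  \<open>T'\<close> and \<open>T\<close> meet on either side of the inverse. It is kept free of
  realizations so that it applies to \<open>kron (1\<^sub>m m) T\<close> as well as to
  \<open>mat_tensor scale T 1\<close>.\<close>

lemma transfer_conj:
  fixes P :: "'a::{semiring_0, monoid_mult} mat"
  assumes P: "P \<in> carrier_mat n n" and T: "T \<in> carrier_mat n n" "T' \<in> carrier_mat n n"
    and TT': "T * T' = 1\<^sub>m n" "T' * T = 1\<^sub>m n"
    and C: "C \<in> carrier_mat p n" and B: "B \<in> carrier_mat n q"
    and inv: "\<exists>Q. is_mat_inverse P Q"
  shows "(C * T') * mat_inv (T * P * T') * (T * B) = C * mat_inv P * B"
proof -
  obtain Q where PQ: "is_mat_inverse P Q" using inv ..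
  then have Q: "Q \<in> carrier_mat n n" using P by (auto simp: is_mat_inverse_def)
  have "mat_inv P = Q" "mat_inv (T * P * T') = T * Q * T'"
    using PQ is_mat_inverse_conj[OF P T TT' PQ] by (auto intro: mat_inv_eqI)
  moreover have "(C * T') * (T * Q * T') * (T * B) = C * Q * B"
  proof -
    have "(C * T') * (T * Q * T') = C * T' * (T * (Q * T'))"
      using T Q by (subst assoc_mult_mat[of T n n Q n T' n]) auto
    also have "\<dots> = C * (Q * T')"
      using C T Q TT' by (intro mult_cancel_mid_mat[of _ p n]) auto
    also have "\<dots> = C * Q * T'" using C T Q by simp
    finally show ?thesis
      using C T Q TT' B by (simp only:) (intro mult_cancel_mid_mat[of _ p n], auto)
  qed
  ultimately show ?thesis by simp
qed

text \<open>Brings the determinant condition of \<open>fm_DOM\<close> into the form used in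
  \<open>fm_alg_DOM\<close>, so that one conjugation argument handles both domains.\<close>

lemma det_nonzero_iff_is_mat_inverse:
  fixes P :: "'k::field mat"
  assumes P: "P \<in> carrier_mat n n"
  shows "det P \<noteq> 0 \<longleftrightarrow> (\<exists>Q. is_mat_inverse P Q)"
proof
  assume "det P \<noteq> 0"
  then have "P \<in> Units (ring_mat TYPE('k) n 0)" by (rule det_non_zero_imp_unit[OF P])
  then show "\<exists>Q. is_mat_inverse P Q"
    using P by (auto simp: Units_def ring_mat_simps is_mat_inverse_def)
next
  assume "\<exists>Q. is_mat_inverse P Q"
  then obtain Q where "Q \<in> carrier_mat n n" "P * Q = 1\<^sub>m n"
    using P by (auto simp: is_mat_inverse_def)
  then have "det P * det Q = 1" using det_mult[OF P] det_one by metis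
  then show "det P \<noteq> 0" by auto
qed

text \<open>If \<open>n < m\<close>, the padded \<open>A\<close> has a zero row and so determinant
  zero, although the padded product is still the identity. Applied to \<open>T\<close> and
  \<open>T'\<close> in both orders, this yields equality of the state dimensions.\<close>

lemma left_inverse_mat_dim_le:
  fixes A :: "'k::field mat"
  assumes A: "A \<in> carrier_mat n m" and B: "B \<in> carrier_mat m n" and BA: "B * A = 1\<^sub>m m"
  shows "m \<le> n"
proof (rule ccontr)
  assume "\<not> m \<le> n"
  then have nm: "n < m" by simp
  \<comment> \<open>pad \<open>A\<close> with zero rows and \<open>B\<close> with zero columns to square matrices\<close>
  define A' where "A' = mat m m (\<lambda>(i, j). if i < n then A $$ (i, j) else 0)"
  define B' where "B' = mat m m (\<lambda>(i, j). if j < n then B $$ (i, j) else 0)"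
  have A': "A' \<in> carrier_mat m m" and B': "B' \<in> carrier_mat m m" by (auto simp: A'_def B'_def)
  have "B' * A' = B * A"
  proof (rule eq_matI)
    fix i j assume "i < dim_row (B * A)" "j < dim_col (B * A)"
    then have ij: "i < m" "j < m" using A B by auto
    have "(B' * A') $$ (i, j) = (\<Sum>c<m. B' $$ (i, c) * A' $$ (c, j))"
      by (rule index_mult_mat_sum[OF B' A' ij])
    also have "\<dots> = (\<Sum>c<n. B $$ (i, c) * A $$ (c, j))"
      using nm ij by (intro sum.mono_neutral_cong_right) (auto simp: A'_def B'_def)
    also have "\<dots> = (B * A) $$ (i, j)" by (rule index_mult_mat_sum[OF B A ij, symmetric])
    finally show "(B' * A') $$ (i, j) = (B * A) $$ (i, j)" .
  qed (use A B A' B' in auto)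
  then have "det B' * det A' = 1" using BA det_mult[OF B' A'] det_one by metis
  \<comment> \<open>Row \<open>n\<close> exists since \<open>n < m\<close>, and it belongs to the
    padding.\<close>
  moreover have "A' = mat\<^sub>r m m (\<lambda>i. if i = n then 0\<^sub>v m else row A' i)"
    by (rule eq_matI) (auto simp: A'_def)
  then have "det A' = 0"
    using det_row_0[OF nm, of "row A'"] A' by auto
  ultimately show False by simp
qed

lemma mult_unit_vec_eqI:
  fixes A :: "'k::semiring_1 mat"
  assumes "A \<in> carrier_mat n m" "B \<in> carrier_mat n m"
    and "\<And>v. v \<in> carrier_vec m \<Longrightarrow> A *\<^sub>v v = B *\<^sub>v v"
  shows "A = B"
proof (rule eq_matI)
  fix i j assume "i < dim_row B" "j < dim_col B"
  moreover then have "(A *\<^sub>v unit_vec m j) $ i = (B *\<^sub>v unit_vec m j) $ i"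
    using assms by simp
  ultimately show "A $$ (i, j) = B $$ (i, j)" using assms(1,2) by simp
qed (use assms in auto)

section \<open>Matrices assembled from blocks of equal size, and products with an identity Kronecker
  factor\<close>

section \<open>Block matrices\<close>

text \<open>A common normal form for \<open>blockwise\<close> and for
  \<open>kron (1\<^sub>m m) T\<close>, which share this index layout. The blocks come from a
  function on all index pairs, of which only those below \<open>m\<close> matter.\<close>

definition blockmat :: "nat \<Rightarrow> nat \<Rightarrow> nat \<Rightarrow> (nat \<Rightarrow> nat \<Rightarrow> 'a mat) \<Rightarrow> 'a mat" where
  "blockmat p q m F = mat (p * m) (q * m) (\<lambda>(a, b). F (a div p) (b div q) $$ (a mod p, b mod q))"

lemma blockmat_carrier [simp]: "blockmat p q m F \<in> carrier_mat (p * m) (q * m)"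
  by (simp add: blockmat_def)

lemma less_mult_divD:
  fixes a :: nat
  assumes "a < p * m"
  shows "a div p < m" "a mod p < p"
proof -
  have "p > 0" using assms by (cases p) auto
  then show "a div p < m" "a mod p < p"
    using assms by (auto simp: less_mult_imp_div_less mult.commute)
qed

lemma block_index_less: "i < m \<Longrightarrow> a < p \<Longrightarrow> i * p + a < p * (m::nat)"
proof -
  assume "i < m" "a < p"
  then have "i * p + a < Suc i * p" by simp
  also have "\<dots> \<le> m * p" using \<open>i < m\<close> by (intro mult_right_mono) auto
  finally show ?thesis by (simp add: mult.commute)
qed

lemma blockmat_index:
  assumes "i < m" "j < m" "a < p" "b < q"
  shows "blockmat p q m F $$ (i * p + a, j * q + b) = F i j $$ (a, b)"
  using assms by (simp add: blockmat_def block_index_less)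

lemma blockmat_cong:
  assumes "\<And>i j a b. i < m \<Longrightarrow> j < m \<Longrightarrow> a < p \<Longrightarrow> b < q \<Longrightarrow> F i j $$ (a, b) = G i j $$ (a, b)"
  shows "blockmat p q m F = blockmat p q m G"
  unfolding blockmat_def by (rule cong_mat) (auto intro!: assms less_mult_divD)

lemma blockmat_add:
  assumes "\<And>i j. F i j \<in> carrier_mat p q" "\<And>i j. G i j \<in> carrier_mat p q"
  shows "blockmat p q m F + blockmat p q m G = blockmat p q m (\<lambda>i j. F i j + G i j)"
proof (rule eq_matI)
  fix a b
  assume "a < dim_row (blockmat p q m (\<lambda>i j. F i j + G i j))"
    "b < dim_col (blockmat p q m (\<lambda>i j. F i j + G i j))"
  then have ab: "a < p * m" "b < q * m" by (auto simp: blockmat_def)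
  have "G i j \<in> carrier_mat p q" for i j using assms by simp
  then show "(blockmat p q m F + blockmat p q m G) $$ (a, b) =
      blockmat p q m (\<lambda>i j. F i j + G i j) $$ (a, b)"
    using ab less_mult_divD[OF ab(1)] less_mult_divD[OF ab(2)]
    by (simp add: blockmat_def carrier_matD[of _ p q])
qed (auto simp: blockmat_def)

text \<open>Division with remainder as a reindexing: it splits the inner sum of a matrix product
  into a sum over blocks and a sum inside each block.\<close>

lemma sum_lessThan_mult:
  fixes f :: "nat \<Rightarrow> 'a::comm_monoid_add"
  shows "(\<Sum>c<q * m. f c) = (\<Sum>l<m. \<Sum>r<q. f (l * q + r))"
proof (induction m)
  case (Suc m)
  have "(\<Sum>c<q * Suc m. f c) = (\<Sum>c<q * m. f c) + (\<Sum>c\<in>{q * m..<q * m + q}. f c)"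
    unfolding lessThan_atLeast0 by (subst sum.atLeastLessThan_concat) (simp_all add: add.commute)
  also have "(\<Sum>c\<in>{q * m..<q * m + q}. f c) = (\<Sum>r<q. f (m * q + r))"
    using sum.shift_bounds_nat_ivl[of f 0 "q * m" q]
    by (simp add: lessThan_atLeast0 add.commute mult.commute)
  finally show ?case using Suc by simp
qed simp

lemma blockmat_mult:
  assumes F: "\<And>i j. F i j \<in> carrier_mat p q" and G: "\<And>i j. G i j \<in> carrier_mat q r"
  shows "blockmat p q m F * blockmat q r m G =
    blockmat p r m (\<lambda>i j. mat_sum p r (\<lambda>l. F i l * G l j) {..<m})" (is "_ = ?H")
proof (rule eq_matI)
  fix a b assume "a < dim_row ?H" "b < dim_col ?H"
  then have ab: "a < p * m" "b < r * m" by (auto simp: blockmat_def)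
  note dm = less_mult_divD[OF ab(1)] less_mult_divD[OF ab(2)]
  have "(blockmat p q m F * blockmat q r m G) $$ (a, b) =
      (\<Sum>c<q * m. blockmat p q m F $$ (a, c) * blockmat q r m G $$ (c, b))"
    by (rule index_mult_mat_sum[OF _ _ ab]) auto
  also have "\<dots> = (\<Sum>l<m. \<Sum>c<q. F (a div p) l $$ (a mod p, c) * G l (b div r) $$ (c, b mod r))"
    unfolding sum_lessThan_mult
    by (intro sum.cong refl) (use ab in \<open>auto simp: blockmat_def block_index_less\<close>)
  also have "\<dots> = (\<Sum>l<m. (F (a div p) l * G l (b div r)) $$ (a mod p, b mod r))"
    using F G dm by (intro sum.cong refl index_mult_mat_sum[symmetric]) auto
  also have "\<dots> = ?H $$ (a, b)" using ab dm by (simp add: blockmat_def mat_sum_def)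
  finally show "(blockmat p q m F * blockmat q r m G) $$ (a, b) = ?H $$ (a, b)" .
qed (auto simp: blockmat_def)

lemma kron_one_eq_blockmat:
  fixes T :: "'k::semiring_1 mat"
  assumes "T \<in> carrier_mat p q"
  shows "kron (1\<^sub>m m) T = blockmat p q m (\<lambda>i j. if i = j then T else 0\<^sub>m p q)"
proof -
  have "(1\<^sub>m m $$ (a div p, b div q) :: 'k) * T $$ (a mod p, b mod q) =
      (if a div p = b div q then T else 0\<^sub>m p q) $$ (a mod p, b mod q)"
    if "a < p * m" "b < q * m" for a b
    using less_mult_divD[OF that(1)] less_mult_divD[OF that(2)] by simp
  then show ?thesis using assms
    by (intro eq_matI) (auto simp: kron_def blockmat_def mult.commute[of m])
qed

lemma blockwise_eq_blockmat:
  "blockwise s m p q T X = blockmat p q m (\<lambda>i j. T (block s X i j))"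
  by (simp add: blockwise_def blockmat_def)

lemma mat_sum_carrier [simp]: "mat_sum p q f S \<in> carrier_mat p q"
  by (simp add: mat_sum_def)

text \<open>Selects the single surviving term when one factor is block diagonal or superdiagonal, or
  when a block involves one variable only.\<close>

lemma mat_sum_if:
  assumes "finite S" "l \<in> S" "M \<in> carrier_mat p q"
    and "\<And>k a b. k \<in> S \<Longrightarrow> a < p \<Longrightarrow> b < q \<Longrightarrow> f k $$ (a, b) = (if k = l then M $$ (a, b) else 0)"
  shows "mat_sum p q f S = M"
proof (rule eq_matI)
  fix a b assume "a < dim_row M" "b < dim_col M"
  then have ab: "a < p" "b < q" using assms by auto
  then have "mat_sum p q f S $$ (a, b) = (\<Sum>k\<in>S. if k = l then M $$ (a, b) else 0)"
    using assms(4) by (simp add: mat_sum_def)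
  then show "mat_sum p q f S $$ (a, b) = M $$ (a, b)" using assms by simp
qed (use assms in \<open>auto simp: mat_sum_def\<close>)

lemma kron_one_mult_blockmat:
  fixes T :: "'k::semiring_1 mat"
  assumes T: "T \<in> carrier_mat p q" and G: "\<And>i j. G i j \<in> carrier_mat q r"
  shows "kron (1\<^sub>m m) T * blockmat q r m G = blockmat p r m (\<lambda>i j. T * G i j)"
proof -
  have "kron (1\<^sub>m m) T * blockmat q r m G = blockmat p r m
      (\<lambda>i j. mat_sum p r (\<lambda>l. (if i = l then T else 0\<^sub>m p q) * G l j) {..<m})"
    unfolding kron_one_eq_blockmat[OF T] by (rule blockmat_mult) (use T G in auto)
  also have "\<dots> = blockmat p r m (\<lambda>i j. T * G i j)"
  proof (rule blockmat_cong)
    fix i j a b assume ij: "i < m" "j < m"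
    have "mat_sum p r (\<lambda>l. (if i = l then T else 0\<^sub>m p q) * G l j) {..<m} = T * G i j"
      using T G ij by (intro mat_sum_if[of _ i]) (auto simp: left_mult_zero_mat[OF G])
    then show "mat_sum p r (\<lambda>l. (if i = l then T else 0\<^sub>m p q) * G l j) {..<m} $$ (a, b) =
        (T * G i j) $$ (a, b)" by simp
  qed
  finally show ?thesis .
qed

lemma blockmat_mult_kron_one:
  fixes T :: "'k::semiring_1 mat"
  assumes T: "T \<in> carrier_mat q r" and F: "\<And>i j. F i j \<in> carrier_mat p q"
  shows "blockmat p q m F * kron (1\<^sub>m m) T = blockmat p r m (\<lambda>i j. F i j * T)"
proof -
  have "blockmat p q m F * kron (1\<^sub>m m) T = blockmat p r m
      (\<lambda>i j. mat_sum p r (\<lambda>l. F i l * (if l = j then T else 0\<^sub>m q r)) {..<m})"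
    unfolding kron_one_eq_blockmat[OF T] by (rule blockmat_mult) (use T F in auto)
  also have "\<dots> = blockmat p r m (\<lambda>i j. F i j * T)"
  proof (rule blockmat_cong)
    fix i j a b assume ij: "i < m" "j < m"
    have "mat_sum p r (\<lambda>l. F i l * (if l = j then T else 0\<^sub>m q r)) {..<m} = F i j * T"
      using T F ij by (intro mat_sum_if[of _ j]) (auto simp: right_mult_zero_mat[OF F] mult_carrier_mat[OF F T])
    then show "mat_sum p r (\<lambda>l. F i l * (if l = j then T else 0\<^sub>m q r)) {..<m} $$ (a, b) =
        (F i j * T) $$ (a, b)" by simp
  qed
  finally show ?thesis .
qed

lemma one_mat_eq_kron: "1\<^sub>m (p * m) = kron (1\<^sub>m m) (1\<^sub>m p :: 'k::semiring_1 mat)"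
proof (rule eq_matI)
  fix a b assume "a < dim_row (kron (1\<^sub>m m) (1\<^sub>m p :: 'k mat))" "b < dim_col (kron (1\<^sub>m m) (1\<^sub>m p :: 'k mat))"
  then have ab: "a < p * m" "b < p * m" by (auto simp: kron_def mult.commute)
  have "a = b \<longleftrightarrow> a div p = b div p \<and> a mod p = b mod p"
    by (metis div_mult_mod_eq)
  then show "1\<^sub>m (p * m) $$ (a, b) = kron (1\<^sub>m m) (1\<^sub>m p :: 'k mat) $$ (a, b)"
    using ab less_mult_divD[OF ab(1)] less_mult_divD[OF ab(2)]
    by (simp add: kron_def mult.commute)
qed (simp_all add: kron_def mult.commute)

lemma mat_sum_blockmat:
  assumes "\<And>k i j. F k i j \<in> carrier_mat p q"
  shows "mat_sum (p * m) (q * m) (\<lambda>k. blockmat p q m (F k)) S =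
    blockmat p q m (\<lambda>i j. mat_sum p q (\<lambda>k. F k i j) S)"
  by (rule eq_matI) (use less_mult_divD in \<open>auto simp: mat_sum_def blockmat_def\<close>)

section \<open>Definedness of rational expressions at block upper triangular points\<close>

section \<open>Evaluation at block upper triangular points\<close>

text \<open>Definedness matters in the inversion case: \<open>mat_inv\<close> is a definite
  description, and its size is known only once an inverse exists.\<close>

lemma nc_eval_carrier:
  assumes "\<And>k. X k \<in> carrier_mat n n" "nc_defined n X R"
  shows "nc_eval n X R \<in> carrier_mat n n"
  using assms(2)
proof (induction R)
  case (NCInv R)
  then have "nc_eval n X R \<in> carrier_mat n n" "invertible_mat (nc_eval n X R)" by auto
  then obtain Q where "is_mat_inverse (nc_eval n X R) Q"
    unfolding invertible_mat_iff_is_mat_inverse by auto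
  then show ?case using \<open>nc_eval n X R \<in> carrier_mat n n\<close> mat_inv_eqI[of _ Q]
    by (auto simp: is_mat_inverse_def)
qed (auto simp: nc_poly_eval_def)

lemma mult_four_block_upper:
  assumes "A \<in> carrier_mat n n" "V \<in> carrier_mat n m" "D \<in> carrier_mat m m"
    and "A' \<in> carrier_mat n n" "V' \<in> carrier_mat n m" "D' \<in> carrier_mat m m"
  shows "four_block_mat A V (0\<^sub>m m n) D * four_block_mat A' V' (0\<^sub>m m n) D' =
    four_block_mat (A * A') (A * V' + V * D') (0\<^sub>m m n) (D * D')"
proof -
  have "A * A' + V * 0\<^sub>m m n = A * A'" "0\<^sub>m m n * A' + D * 0\<^sub>m m n = 0\<^sub>m m n"
    "0\<^sub>m m n * V' + D * D' = D * D'"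
    using assms mult_carrier_mat[OF assms(1,4)] mult_carrier_mat[OF assms(3,6)]
    by (simp_all add: right_mult_zero_mat[of _ _ m] left_mult_zero_mat[of _ n]
        right_mult_zero_mat[of D m m])
  then show ?thesis
    by (subst mult_four_block_mat[OF assms(1,2) zero_carrier_mat assms(3-5) zero_carrier_mat assms(6)])
      simp
qed

text \<open>The corner \<open>Z\<close> of the inverse must satisfy
  \<open>P * Z + V * Q' = 0\<close>, which forces \<open>Z = - (P' * V * Q')\<close>. The corners of
  the two products vanish by \<open>P * U = V * Q'\<close> and
  \<open>U * Q = P' * V\<close>.\<close>

lemma is_mat_inverse_four_block:
  fixes P :: "'k::field mat"
  assumes P: "P \<in> carrier_mat n n" "is_mat_inverse P P'" and Q: "Q \<in> carrier_mat m m" "is_mat_inverse Q Q'"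
    and V: "V \<in> carrier_mat n m"
  shows "is_mat_inverse (four_block_mat P V (0\<^sub>m m n) Q)
    (four_block_mat P' (- (P' * V * Q')) (0\<^sub>m m n) Q')"
proof -
  have P': "P' \<in> carrier_mat n n" "P * P' = 1\<^sub>m n" "P' * P = 1\<^sub>m n"
    and Q': "Q' \<in> carrier_mat m m" "Q * Q' = 1\<^sub>m m" "Q' * Q = 1\<^sub>m m"
    using P Q by (auto simp: is_mat_inverse_def)
  define U where "U = P' * V * Q'"
  have U: "U \<in> carrier_mat n m" "- U \<in> carrier_mat n m" using P' Q' V by (auto simp: U_def)
  have PU: "P * U = V * Q'"
  proof -
    have VQ: "V * Q' \<in> carrier_mat n m" using V Q' by auto
    have "P * U = P * (P' * (V * Q'))"
      unfolding U_def using assoc_mult_mat[OF P'(1) V Q'(1)] by simp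
    also have "\<dots> = (P * P') * (V * Q')" by (rule assoc_mult_mat[OF P(1) P'(1) VQ, symmetric])
    also have "\<dots> = V * Q'" unfolding P'(2) using VQ by (rule left_mult_one_mat)
    finally show ?thesis .
  qed
  have UQ: "U * Q = P' * V"
  proof -
    have PV: "P' * V \<in> carrier_mat n m" using P' V by auto
    have "U * Q = (P' * V) * (Q' * Q)"
      unfolding U_def by (rule assoc_mult_mat[OF PV Q'(1) Q(1)])
    also have "\<dots> = P' * V" unfolding Q'(3) using PV by (rule right_mult_one_mat)
    finally show ?thesis .
  qed
  have PU_neg: "P * (- U) = - (P * U)" and UQ_neg: "(- U) * Q = - (U * Q)"
    using P U Q by (auto simp: uminus_mult_right_mat uminus_mult_left_mat)
  have z: "- M + M = 0\<^sub>m n m" "M + - M = 0\<^sub>m n m" if "M \<in> carrier_mat n m" for M :: "'k mat"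
    using that by (auto intro!: eq_matI)
  have one: "four_block_mat (1\<^sub>m n) (0\<^sub>m n m) (0\<^sub>m m n) (1\<^sub>m m) = (1\<^sub>m (n + m) :: 'k mat)"
    by (rule eq_matI) auto
  have "V * Q' \<in> carrier_mat n m" "P' * V \<in> carrier_mat n m" using P' Q' V by auto
  note z = z(1)[OF this(1)] z(2)[OF this(2)]
  have "four_block_mat P V (0\<^sub>m m n) Q * four_block_mat P' (- U) (0\<^sub>m m n) Q' = 1\<^sub>m (n + m)"
    unfolding mult_four_block_upper[OF P(1) V Q(1) P'(1) U(2) Q'(1)] P'(2) Q'(2) PU_neg PU z one ..
  moreover have "four_block_mat P' (- U) (0\<^sub>m m n) Q' * four_block_mat P V (0\<^sub>m m n) Q = 1\<^sub>m (n + m)"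
    unfolding mult_four_block_upper[OF P'(1) U(2) Q'(1) P(1) V Q(1)] P'(3) Q'(3) UQ_neg UQ z one ..
  ultimately show ?thesis
    unfolding is_mat_inverse_def U_def[symmetric]
    by (intro exI[of _ "n + m"]) (use P P' Q Q' U V in auto)
qed

lemma mat_sum_four_block:
  assumes "\<And>w. A w \<in> carrier_mat n n" "\<And>w. B w \<in> carrier_mat n m" "\<And>w. D w \<in> carrier_mat m m"
  shows "mat_sum (n + m) (n + m) (\<lambda>w. four_block_mat (A w) (B w) (0\<^sub>m m n) (D w)) S =
    four_block_mat (mat_sum n n A S) (mat_sum n m B S) (0\<^sub>m m n) (mat_sum m m D S)"
proof (rule eq_matI)
  let ?M = "four_block_mat (mat_sum n n A S) (mat_sum n m B S) (0\<^sub>m m n) (mat_sum m m D S)"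
  fix i j assume "i < dim_row ?M" "j < dim_col ?M"
  then have ij: "i < n + m" "j < n + m" by (auto simp: mat_sum_def)
  have d: "dim_row (A w) = n" "dim_col (A w) = n" "dim_row (D w) = m" "dim_col (D w) = m" for w
    using assms by auto
  show "mat_sum (n + m) (n + m) (\<lambda>w. four_block_mat (A w) (B w) (0\<^sub>m m n) (D w)) S $$ (i, j) = ?M $$ (i, j)"
    using ij by (auto simp: mat_sum_def d)
qed (auto simp: mat_sum_def)

text \<open>The diagonal blocks are tracked exactly because they decide invertibility in the
  inversion case. The corner \<open>W\<close> may stay existential: later only definedness at the
  large point is extracted.\<close>

lemma nc_eval_four_block:
  fixes R :: "('d, 'k::field) nc_rat"
  assumes X: "\<And>k. X k \<in> carrier_mat n n" and Z: "\<And>k. Z k \<in> carrier_mat m m"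
    and V: "\<And>k. V k \<in> carrier_mat n m"
    and "nc_defined n X R" "nc_defined m Z R"
  defines "M \<equiv> \<lambda>k. four_block_mat (X k) (V k) (0\<^sub>m m n) (Z k)"
  shows "nc_defined (n + m) M R \<and> (\<exists>W\<in>carrier_mat n m.
    nc_eval (n + m) M R = four_block_mat (nc_eval n X R) W (0\<^sub>m m n) (nc_eval m Z R))"
  using assms(4,5)
proof (induction R)
  case (NCPoly p)
  let ?e = "\<lambda>X n w. foldr (\<lambda>i M. X i * M) w (1\<^sub>m n)"
  have eX: "?e X n w \<in> carrier_mat n n" for w by (induction w) (auto intro: mult_carrier_mat[OF X])
  have eZ: "?e Z m w \<in> carrier_mat m m" for w by (induction w) (auto intro: mult_carrier_mat[OF Z])
  have "\<exists>W. W \<in> carrier_mat n m \<and> ?e M (n + m) w = four_block_mat (?e X n w) W (0\<^sub>m m n) (?e Z m w)" for w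
  proof (induction w)
    case Nil
    then show ?case by (intro exI[of _ "0\<^sub>m n m"]) auto
  next
    case (Cons i w)
    then obtain W where W: "W \<in> carrier_mat n m"
      "?e M (n + m) w = four_block_mat (?e X n w) W (0\<^sub>m m n) (?e Z m w)" by auto
    have "?e M (n + m) (i # w) = M i * ?e M (n + m) w" by simp
    \<comment> \<open>The corner of a product obeys a Leibniz rule, with \<open>X\<close> acting
      from the left and \<open>Z\<close> from the right.\<close>
    also have "\<dots> = four_block_mat (?e X n (i # w)) (X i * W + V i * ?e Z m w) (0\<^sub>m m n) (?e Z m (i # w))"
      unfolding W(2) unfolding M_def
      unfolding mult_four_block_upper[OF X V Z eX W(1) eZ] by simp
    finally have "?e M (n + m) (i # w) = four_block_mat (?e X n (i # w)) (X i * W + V i * ?e Z m w) (0\<^sub>m m n) (?e Z m (i # w))" .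
    moreover have "X i * W + V i * ?e Z m w \<in> carrier_mat n m"
      using mult_carrier_mat[OF X W(1)] mult_carrier_mat[OF V eZ] by simp
    ultimately show ?case by blast
  qed
  then obtain W where W: "\<And>w. W w \<in> carrier_mat n m"
    "\<And>w. ?e M (n + m) w = four_block_mat (?e X n w) (W w) (0\<^sub>m m n) (?e Z m w)" by metis
  let ?c = "Poly_Mapping.lookup p"
  have "?c w \<cdot>\<^sub>m ?e M (n + m) w =
      four_block_mat (?c w \<cdot>\<^sub>m ?e X n w) (?c w \<cdot>\<^sub>m W w) (0\<^sub>m m n) (?c w \<cdot>\<^sub>m ?e Z m w)" for w
    unfolding W(2) smult_four_block_mat[OF eX W(1) zero_carrier_mat eZ] by simp
  then have "nc_eval (n + m) M (NCPoly p) = mat_sum (n + m) (n + m) (\<lambda>w.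
      four_block_mat (?c w \<cdot>\<^sub>m ?e X n w) (?c w \<cdot>\<^sub>m W w) (0\<^sub>m m n) (?c w \<cdot>\<^sub>m ?e Z m w)) (Poly_Mapping.keys p)"
    by (simp add: nc_poly_eval_def)
  also have "\<dots> = four_block_mat (nc_eval n X (NCPoly p))
      (mat_sum n m (\<lambda>w. ?c w \<cdot>\<^sub>m W w) (Poly_Mapping.keys p)) (0\<^sub>m m n) (nc_eval m Z (NCPoly p))"
    using eX eZ W by (subst mat_sum_four_block) (auto simp: nc_poly_eval_def)
  finally show ?case by auto
next
  case (NCAdd R S)
  then obtain U W where UW: "U \<in> carrier_mat n m" "W \<in> carrier_mat n m"
    "nc_eval (n + m) M R = four_block_mat (nc_eval n X R) U (0\<^sub>m m n) (nc_eval m Z R)"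
    "nc_eval (n + m) M S = four_block_mat (nc_eval n X S) W (0\<^sub>m m n) (nc_eval m Z S)" by auto
  have c: "nc_eval n X R \<in> carrier_mat n n" "nc_eval m Z R \<in> carrier_mat m m"
    "nc_eval n X S \<in> carrier_mat n n" "nc_eval m Z S \<in> carrier_mat m m"
    using NCAdd X Z by (auto intro!: nc_eval_carrier)
  have "nc_eval (n + m) M (NCAdd R S) = four_block_mat (nc_eval n X R + nc_eval n X S) (U + W) (0\<^sub>m m n)
      (nc_eval m Z R + nc_eval m Z S)"
    unfolding nc_eval.simps UW(3,4)
      add_four_block_mat[OF c(1) UW(1) zero_carrier_mat c(2) c(3) UW(2) zero_carrier_mat c(4)] by simp
  then show ?case using NCAdd UW by (auto intro!: bexI[of _ "U + W"])
next
  case (NCMult R S)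
  then obtain U W where UW: "U \<in> carrier_mat n m" "W \<in> carrier_mat n m"
    "nc_eval (n + m) M R = four_block_mat (nc_eval n X R) U (0\<^sub>m m n) (nc_eval m Z R)"
    "nc_eval (n + m) M S = four_block_mat (nc_eval n X S) W (0\<^sub>m m n) (nc_eval m Z S)" by auto
  have c: "nc_eval n X R \<in> carrier_mat n n" "nc_eval m Z R \<in> carrier_mat m m"
    "nc_eval n X S \<in> carrier_mat n n" "nc_eval m Z S \<in> carrier_mat m m"
    using NCMult X Z by (auto intro!: nc_eval_carrier)
  let ?U = "nc_eval n X R * W + U * nc_eval m Z S"
  have "nc_eval (n + m) M (NCMult R S) = four_block_mat (nc_eval n X R * nc_eval n X S) ?U (0\<^sub>m m n)
      (nc_eval m Z R * nc_eval m Z S)"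
    unfolding nc_eval.simps UW(3,4)
      mult_four_block_upper[OF c(1) UW(1) c(2) c(3) UW(2) c(4)] ..
  then show ?case using NCMult UW c by (auto intro!: bexI[of _ ?U])
next
  case (NCInv R)
  then obtain U where U: "U \<in> carrier_mat n m"
    "nc_eval (n + m) M R = four_block_mat (nc_eval n X R) U (0\<^sub>m m n) (nc_eval m Z R)" by auto
  have c: "nc_eval n X R \<in> carrier_mat n n" "nc_eval m Z R \<in> carrier_mat m m"
    using NCInv X Z by (auto intro!: nc_eval_carrier)
  obtain P Q where PQ: "is_mat_inverse (nc_eval n X R) P" "is_mat_inverse (nc_eval m Z R) Q"
    using NCInv.prems unfolding nc_defined.simps invertible_mat_iff_is_mat_inverse by blast
  have i: "is_mat_inverse (nc_eval (n + m) M R) (four_block_mat P (- (P * U * Q)) (0\<^sub>m m n) Q)"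
    unfolding U(2) by (rule is_mat_inverse_four_block[OF c(1) PQ(1) c(2) PQ(2) U(1)])
  have "P \<in> carrier_mat n n" "Q \<in> carrier_mat m m" using c PQ by (auto simp: is_mat_inverse_def)
  then have "- (P * U * Q) \<in> carrier_mat n m" using U by auto
  moreover have "nc_eval (n + m) M (NCInv R) =
      four_block_mat (nc_eval n X (NCInv R)) (- (P * U * Q)) (0\<^sub>m m n) (nc_eval m Z (NCInv R))"
    using mat_inv_eqI[OF i] mat_inv_eqI[OF PQ(1)] mat_inv_eqI[OF PQ(2)] by simp
  moreover have "nc_defined (n + m) M (NCInv R)"
    using NCInv i unfolding nc_defined.simps invertible_mat_iff_is_mat_inverse by blast
  ultimately show ?case by blast
qed

text \<open>Splits off the last block row and column; this is the passage from \<open>m\<close> to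
  \<open>Suc m\<close> in the induction on the number of blocks.\<close>

lemma blockmat_Suc_upper:
  assumes F: "\<And>i j. F i j \<in> carrier_mat s s" and z: "\<And>j. j < m \<Longrightarrow> F m j = 0\<^sub>m s s"
  shows "blockmat s s (Suc m) F = four_block_mat (blockmat s s m F)
    (mat (s * m) s (\<lambda>(a, b). F (a div s) m $$ (a mod s, b))) (0\<^sub>m s (s * m)) (F m m)"
    (is "?l = ?r")
proof (rule eq_matI)
  have dF: "dim_row (F m m) = s" "dim_col (F m m) = s" using F by auto
  fix a b assume "a < dim_row ?r" "b < dim_col ?r"
  then have ab: "a < s * m + s" "b < s * m + s" using dF by (auto simp: blockmat_def)
  \<comment> \<open>Indices from \<open>s * m\<close> on lie in the last block, which has number
    \<open>m\<close>.\<close>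
  have hi: "c div s = m" "c mod s = c - s * m" if "\<not> c < s * m" "c < s * m + s" for c
  proof -
    define r where "r = c - s * m"
    have "c = s * m + r" "r < s" using that by (auto simp: r_def)
    then show "c div s = m" "c mod s = c - s * m" by auto
  qed
  show "?l $$ (a, b) = ?r $$ (a, b)"
  proof (cases "a < s * m")
    case True
    then show ?thesis using ab dF hi[of b]
      by (cases "b < s * m") (simp_all add: blockmat_def)
  next
    case a: False
    then have s: "a - s * m < s" using ab by simp
    show ?thesis
    proof (cases "b < s * m")
      case True
      then have "F m (b div s) = 0\<^sub>m s s" "b mod s < s" using z less_mult_divD by blast+
      then show ?thesis using True a s ab dF hi(1,2)[OF a ab(1)] by (simp add: blockmat_def)
    next
      case False
      then show ?thesis using a s ab dF hi(1,2)[OF a ab(1)] hi(1,2)[OF False ab(2)]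
        by (simp add: blockmat_def)
    qed
  qed
qed (use F[of m m] in \<open>auto simp: blockmat_def\<close>)

text \<open>
  Each superdiagonal block is nonzero for a single variable only, so the top right block of a
  realization at this point consists of one product \<open>C A\<^sub>i\<^sub>1(X\<^sub>1) \<cdots> A\<^sub>i\<^sub>l(X\<^sub>l) B\<^sub>k(X)\<close>.
\<close>

definition chain_point ::
    "nat \<Rightarrow> ('d \<Rightarrow> 'k::zero mat) \<Rightarrow> (nat \<Rightarrow> 'd \<times> 'k mat) \<Rightarrow> nat \<Rightarrow> 'd \<Rightarrow> 'k mat" where
  "chain_point s Y w m k = blockmat s s m (\<lambda>i j. if j = i then Y k
     else if j = Suc i \<and> fst (w i) = k then snd (w i) else 0\<^sub>m s s)"

text \<open>Each step borders the previous point with one more diagonal block \<open>Y\<close>; both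
  diagonal parts lie in the domain, and the new column above \<open>Y\<close> is
  unconstrained.\<close>

lemma chain_point_in_nc_dom:
  fixes R :: "('d, 'k::field) nc_rat"
  assumes Y: "Y \<in> nc_dom s R" and w: "\<And>i. snd (w i) \<in> carrier_mat s s" and "m \<ge> 1"
  shows "chain_point s Y w m \<in> nc_dom (s * m) R"
  using \<open>m \<ge> 1\<close>
proof (induction m rule: nat_induct_at_least)
  case base
  have "chain_point s Y w 1 = Y"
  proof
    fix k show "chain_point s Y w 1 k = Y k"
      using Y carrier_matD[of "Y k" s s]
      by (intro eq_matI) (auto simp: chain_point_def blockmat_def nc_dom_def)
  qed
  then show ?case using Y by simp
next
  case (Suc m)
  let ?F = "\<lambda>k i j. if j = i then Y k else if j = Suc i \<and> fst (w i) = k then snd (w i) else 0\<^sub>m s s"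
  let ?V = "\<lambda>k. mat (s * m) s (\<lambda>(a, b). ?F k (a div s) m $$ (a mod s, b))"
  have Yc: "Y k \<in> carrier_mat s s" for k using Y by (simp add: nc_dom_def)
  have eq: "chain_point s Y w (Suc m) =
      (\<lambda>k. four_block_mat (chain_point s Y w m k) (?V k) (0\<^sub>m s (s * m)) (Y k))"
  proof
    fix k
    have "chain_point s Y w (Suc m) k =
        four_block_mat (blockmat s s m (?F k)) (?V k) (0\<^sub>m s (s * m)) (?F k m m)"
      unfolding chain_point_def by (rule blockmat_Suc_upper) (use Yc w in auto)
    then show "chain_point s Y w (Suc m) k =
        four_block_mat (chain_point s Y w m k) (?V k) (0\<^sub>m s (s * m)) (Y k)"
      by (simp add: chain_point_def)
  qed
  have "nc_defined (s * m + s) (chain_point s Y w (Suc m)) R"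
    unfolding eq
    by (rule conjunct1[OF nc_eval_four_block]) (use Suc.IH Y in \<open>auto simp: nc_dom_def\<close>)
  moreover have "chain_point s Y w (Suc m) k \<in> carrier_mat (s * Suc m) (s * Suc m)" for k
    unfolding chain_point_def by (rule blockmat_carrier)
  ultimately show ?case by (simp add: nc_dom_def add.commute)
qed

section \<open>Values of a realization at a chain point, and equality of the moments\<close>

section \<open>Moments\<close>

lemma linear_mat_map_zero:
  assumes "linear_mat_map r c p q T"
  shows "T (0\<^sub>m r c) = 0\<^sub>m p q"
proof -
  have "(0::'a) \<cdot>\<^sub>m 0\<^sub>m r c = (0\<^sub>m r c :: 'a mat)" by (rule eq_matI) auto
  moreover have "T ((0::'a) \<cdot>\<^sub>m 0\<^sub>m r c) = 0 \<cdot>\<^sub>m T (0\<^sub>m r c)" "T (0\<^sub>m r c) \<in> carrier_mat p q"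
    using assms zero_carrier_mat[of r c] unfolding linear_mat_map_def by blast+
  ultimately have "T (0\<^sub>m r c) = 0 \<cdot>\<^sub>m T (0\<^sub>m r c)" by simp
  also have "\<dots> = 0\<^sub>m p q" using \<open>T (0\<^sub>m r c) \<in> carrier_mat p q\<close> by (intro eq_matI) auto
  finally show ?thesis .
qed

text \<open>Subtracting the Kronecker product with \<open>Y\<close> clears the diagonal, linearity
  sends zero blocks to zero, and block \<open>(i, Suc i)\<close> receives a contribution only from
  the variable \<open>fst (w i)\<close>. The map \<open>T\<close> is general so as to cover both the
  \<open>A\<close> part and the \<open>B\<close> part.\<close>

lemma chain_blockwise_sum:
  fixes Y :: "'d::finite \<Rightarrow> 'k::field mat"
  assumes Y: "\<And>k. Y k \<in> carrier_mat s s" and w: "\<And>i. snd (w i) \<in> carrier_mat s s"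
    and T: "\<And>k. linear_mat_map s s p q (T k)"
  shows "mat_sum (p * m) (q * m)
      (\<lambda>k. blockwise s m p q (T k) (chain_point s Y w m k - kron (1\<^sub>m m) (Y k))) UNIV =
    blockmat p q m (\<lambda>i j. if j = Suc i then T (fst (w i)) (snd (w i)) else 0\<^sub>m p q)"
proof -
  let ?N = "\<lambda>k i j. if j = Suc i \<and> fst (w i) = k then snd (w i) else 0\<^sub>m s s"
  have Tc: "T k X \<in> carrier_mat p q" if "X \<in> carrier_mat s s" for k X
    using T that by (auto simp: linear_mat_map_def)
  have Nc: "?N k i j \<in> carrier_mat s s" for k i j using w by auto
  have blk: "block s (chain_point s Y w m k - kron (1\<^sub>m m) (Y k)) i j = ?N k i j"
    if "i < m" "j < m" for k i j
  proof (rule eq_matI)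
    fix a b assume "a < dim_row (?N k i j)" "b < dim_col (?N k i j)"
    then have ab: "a < s" "b < s" by (simp_all only: carrier_matD[OF Nc])
    have "(chain_point s Y w m k - kron (1\<^sub>m m) (Y k)) $$ (i * s + a, j * s + b) =
        chain_point s Y w m k $$ (i * s + a, j * s + b) - kron (1\<^sub>m m) (Y k) $$ (i * s + a, j * s + b)"
      by (rule index_minus_mat(1))
        (use that ab block_index_less in \<open>auto simp: kron_one_eq_blockmat[OF Y] blockmat_def\<close>)
    also have "\<dots> = ?N k i j $$ (a, b)"
      unfolding kron_one_eq_blockmat[OF Y] chain_point_def blockmat_index[OF that ab]
      using ab w[of i] by auto
    finally show "block s (chain_point s Y w m k - kron (1\<^sub>m m) (Y k)) i j $$ (a, b) = ?N k i j $$ (a, b)"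
      using ab by (simp add: block_def)
  qed (simp_all only: block_def dim_row_mat dim_col_mat carrier_matD[OF Nc])
  have "blockwise s m p q (T k) (chain_point s Y w m k - kron (1\<^sub>m m) (Y k)) =
      blockmat p q m (\<lambda>i j. T k (?N k i j))" for k
    unfolding blockwise_eq_blockmat by (rule blockmat_cong) (simp add: blk)
  then have "mat_sum (p * m) (q * m)
      (\<lambda>k. blockwise s m p q (T k) (chain_point s Y w m k - kron (1\<^sub>m m) (Y k))) UNIV =
    mat_sum (p * m) (q * m) (\<lambda>k. blockmat p q m (\<lambda>i j. T k (?N k i j))) UNIV" by presburger
  also have "\<dots> = blockmat p q m (\<lambda>i j. mat_sum p q (\<lambda>k. T k (?N k i j)) UNIV)"
    by (rule mat_sum_blockmat) (rule Tc[OF Nc])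
  also have "\<dots> = blockmat p q m (\<lambda>i j. if j = Suc i then T (fst (w i)) (snd (w i)) else 0\<^sub>m p q)"
  proof (rule blockmat_cong)
    fix i j a b assume "a < p" "b < q"
    have "mat_sum p q (\<lambda>k. T k (?N k i j)) UNIV =
        (if j = Suc i then T (fst (w i)) (snd (w i)) else 0\<^sub>m p q)"
      by (rule mat_sum_if[where l = "fst (w i)"])
        (use w in \<open>auto simp: Tc linear_mat_map_zero[OF T]\<close>)
    then show "mat_sum p q (\<lambda>k. T k (?N k i j)) UNIV $$ (a, b) =
      (if j = Suc i then T (fst (w i)) (snd (w i)) else 0\<^sub>m p q) $$ (a, b)" by simp
  qed
  finally show ?thesis .
qed

lemma fm_word_simps [simp]:
  "fm_word F [] = 1\<^sub>m (fm_L F)"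
  "fm_word F ((k, X) # w) = fm_A F k X * fm_word F w"
  by (simp_all add: fm_word_def)

locale fm_real =
  fixes s :: nat and F :: "('d, 'k::field) fm"
  assumes fm: "fm_realization s F"
begin

abbreviation "L \<equiv> fm_L F"

lemma carriers [simp]:
  "fm_D F \<in> carrier_mat s s" "fm_C F \<in> carrier_mat s L"
  "X \<in> carrier_mat s s \<Longrightarrow> fm_A F k X \<in> carrier_mat L L"
  "X \<in> carrier_mat s s \<Longrightarrow> fm_B F k X \<in> carrier_mat L s"
  using fm by (auto simp: fm_realization_def linear_mat_map_def)

lemma linear: "linear_mat_map s s L L (fm_A F k)" "linear_mat_map s s L s (fm_B F k)"
  using fm by (auto simp: fm_realization_def)

lemma fm_word_carrier [simp]: "snd ` set w \<subseteq> carrier_mat s s \<Longrightarrow> fm_word F w \<in> carrier_mat L L"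
  by (induction w) (auto intro!: mult_carrier_mat[of _ L L])

text \<open>Block \<open>(i, j)\<close> of the finite Neumann series for the inverse of
  \<open>I - N\<close> times \<open>B\<close>. With superdiagonal \<open>N\<close> and
  \<open>B\<close> only one path leads from \<open>i\<close> to \<open>j\<close>: letters
  \<open>i\<close> to \<open>j - 2\<close> act through \<open>A\<close>, and letter
  \<open>j - 1\<close> is the input through \<open>B\<close>.\<close>

definition chain_state :: "(nat \<Rightarrow> 'd \<times> 'k mat) \<Rightarrow> nat \<Rightarrow> nat \<Rightarrow> 'k mat" where
  "chain_state w i j = (if i < j
     then fm_word F (map w [i..<j - 1]) * fm_B F (fst (w (j - 1))) (snd (w (j - 1)))
     else 0\<^sub>m L s)"

lemma chain_state_carrier:
  assumes "\<And>i. snd (w i) \<in> carrier_mat s s"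
  shows "chain_state w i j \<in> carrier_mat L s"
  proof -
  have "snd ` set (map w [i..<j - 1]) \<subseteq> carrier_mat s s" using assms by auto
  then show ?thesis
    unfolding chain_state_def using mult_carrier_mat[OF fm_word_carrier carriers(4)] assms by simp
qed

text \<open>Row \<open>i\<close> of the fixed point equation \<open>W = B + N * W\<close>, obtained
  by peeling the first letter off the word.\<close>

lemma chain_state_step:
  assumes w: "\<And>i. snd (w i) \<in> carrier_mat s s"
  shows "chain_state w i j = (if j = Suc i then fm_B F (fst (w i)) (snd (w i)) else 0\<^sub>m L s) +
    fm_A F (fst (w i)) (snd (w i)) * chain_state w (Suc i) j"
proof -
  note cA = carriers(3)[OF w] and cB = carriers(4)[OF w]
  consider "j \<le> i" | "j = Suc i" | "Suc i < j" by linarith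
  then show ?thesis
  proof cases
    case 3
    then have "[i..<j - 1] = i # [Suc i..<j - 1]" by (simp add: upt_conv_Cons)
    then have "chain_state w i j = fm_A F (fst (w i)) (snd (w i)) * fm_word F (map w [Suc i..<j - 1]) *
        fm_B F (fst (w (j - 1))) (snd (w (j - 1)))"
      using 3 by (cases "w i") (auto simp: chain_state_def)
    also have "\<dots> = fm_A F (fst (w i)) (snd (w i)) * chain_state w (Suc i) j"
      using 3 w by (subst assoc_mult_mat[OF cA fm_word_carrier cB]) (auto simp: chain_state_def)
    also have "\<dots> = 0\<^sub>m L s + fm_A F (fst (w i)) (snd (w i)) * chain_state w (Suc i) j"
      by (rule left_add_zero_mat[symmetric, OF mult_carrier_mat[OF cA chain_state_carrier[of w, OF w]]])
    finally show ?thesis using 3 by simp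
  next
    case 1
    then show ?thesis using right_mult_zero_mat[OF cA] by (simp add: chain_state_def)
  next
    case 2
    then show ?thesis
      using right_mult_zero_mat[OF cA] left_mult_one_mat[OF cB] right_add_zero_mat[OF cB]
      by (simp add: chain_state_def)
  qed
qed

end

locale fm_real_fin = fm_real s F for s :: nat and F :: "('d::finite, 'k::field) fm"
begin

text \<open>The matrix \<open>?W\<close> of chain states solves \<open>?P * ?W = ?B\<close>. The
  inverse \<open>Q\<close> supplied by \<open>fm_DOM\<close> turns this into
  \<open>Q * ?B = ?W\<close>, which is inserted into the transfer formula.\<close>

lemma fm_eval_chain_point:
  assumes Y: "\<And>k. Y k \<in> carrier_mat s s" and w: "\<And>i. snd (w i) \<in> carrier_mat s s"
    and dom: "chain_point s Y w m \<in> fm_DOM s Y F m"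
  shows "fm_eval s Y F m (chain_point s Y w m) =
    blockmat s s m (\<lambda>i j. (if i = j then fm_D F else 0\<^sub>m s s) + fm_C F * chain_state w i j)"
proof -
  let ?Bf = "\<lambda>i j. if j = Suc i then fm_B F (fst (w i)) (snd (w i)) else 0\<^sub>m L s"
  let ?Nf = "\<lambda>i j. if j = Suc i then fm_A F (fst (w i)) (snd (w i)) else 0\<^sub>m L L"
  let ?B = "blockmat L s m ?Bf" and ?N = "blockmat L L m ?Nf"
  let ?W = "blockmat L s m (chain_state w)"
  let ?P = "fm_pencil s Y F m (chain_point s Y w m)"
  note Wc = chain_state_carrier[of w, OF w]
  have P: "?P = 1\<^sub>m (L * m) - ?N"
    unfolding fm_pencil_def by (simp only: chain_blockwise_sum[where Y = Y and w = w, OF Y w linear(1)])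
  have Pc: "?P \<in> carrier_mat (L * m) (L * m)" unfolding P by (rule minus_carrier_mat) simp
  have NW: "?N * ?W = blockmat L s m (\<lambda>i j. if Suc i < m
      then fm_A F (fst (w i)) (snd (w i)) * chain_state w (Suc i) j else 0\<^sub>m L s)" (is "_ = blockmat _ _ _ ?NW")
  proof -
    have "?N * ?W = blockmat L s m (\<lambda>i j. mat_sum L s (\<lambda>l. ?Nf i l * chain_state w l j) {..<m})"
      by (rule blockmat_mult) (use w Wc in auto)
    also have "\<dots> = blockmat L s m ?NW"
    proof (rule blockmat_cong)
      fix i j a b assume "i < m" "j < m" "a < L" "b < s"
      show "mat_sum L s (\<lambda>l. ?Nf i l * chain_state w l j) {..<m} $$ (a, b) = ?NW i j $$ (a, b)"
      proof (cases "Suc i < m")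
        case True
        have "mat_sum L s (\<lambda>l. ?Nf i l * chain_state w l j) {..<m} =
            fm_A F (fst (w i)) (snd (w i)) * chain_state w (Suc i) j"
          by (rule mat_sum_if[where l = "Suc i"])
            (use True in \<open>auto simp: left_mult_zero_mat[OF Wc] mult_carrier_mat[OF carriers(3)[OF w] Wc]\<close>)
        then show ?thesis using True by simp
      next
        case False
        then have "(\<Sum>l<m. (?Nf i l * chain_state w l j) $$ (a, b)) = 0"
          using \<open>i < m\<close> \<open>a < L\<close> \<open>b < s\<close> by (intro sum.neutral) (auto simp: left_mult_zero_mat[OF Wc])
        then show ?thesis using False \<open>a < L\<close> \<open>b < s\<close> by (simp add: mat_sum_def)
      qed
    qed
    finally show ?thesis .
  qed
  have "?B + ?N * ?W = blockmat L s m (\<lambda>i j. ?Bf i j + ?NW i j)"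
    unfolding NW by (rule blockmat_add) (use w in \<open>auto intro!: mult_carrier_mat[OF carriers(3)[OF w] Wc]\<close>)
  also have "\<dots> = ?W"
  proof (rule blockmat_cong)
    fix i j a b assume *: "i < m" "j < m"
    \<comment> \<open>In the last block row the truncated \<open>?N\<close> contributes nothing. The
      recursion agrees, since \<open>j < m\<close> then gives \<open>j \<le> Suc i\<close>, where
      the chain state is zero.\<close>
    have "fm_A F (fst (w i)) (snd (w i)) * chain_state w (Suc i) j = 0\<^sub>m L s" if "\<not> Suc i < m"
      using that * right_mult_zero_mat[OF carriers(3)[OF w]] by (simp add: chain_state_def)
    then show "(?Bf i j + ?NW i j) $$ (a, b) = chain_state w i j $$ (a, b)"
      unfolding chain_state_step[of w i j, OF w] by auto
  qed
  finally have BNW: "?B + ?N * ?W = ?W" .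
  have NWc: "?N * ?W \<in> carrier_mat (L * m) (s * m)" unfolding NW by simp
  have "?P * ?W = ?W - ?N * ?W"
    unfolding P minus_mult_distrib_mat[OF one_carrier_mat blockmat_carrier blockmat_carrier]
      left_mult_one_mat[OF blockmat_carrier] ..
  also have "\<dots> = ?B"
  proof -
    have "M + N - N = M" if "M \<in> carrier_mat p q" "N \<in> carrier_mat p q" for M N :: "'k mat" and p q
      using that by (intro eq_matI) auto
    from this[OF blockmat_carrier[of L s m ?Bf] NWc] show ?thesis unfolding BNW .
  qed
  finally have PW: "?P * ?W = ?B" .
  obtain Q where Q: "is_mat_inverse ?P Q"
    using dom det_nonzero_iff_is_mat_inverse[OF Pc] by (auto simp: fm_DOM_def)
  then have Qc: "Q \<in> carrier_mat (L * m) (L * m)" "Q * ?P = 1\<^sub>m (L * m)" using Pc by (auto simp: is_mat_inverse_def)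
  have "Q * ?B = Q * ?P * ?W"
    unfolding PW[symmetric] by (rule assoc_mult_mat[symmetric, OF Qc(1) Pc blockmat_carrier])
  also have "\<dots> = ?W" unfolding Qc(2) by (rule left_mult_one_mat[OF blockmat_carrier])
  finally have QB: "Q * ?B = ?W" .
  have Cc: "kron (1\<^sub>m m) (fm_C F) \<in> carrier_mat (s * m) (L * m)"
    unfolding kron_one_eq_blockmat[OF carriers(2)] by simp
  have "fm_eval s Y F m (chain_point s Y w m) = kron (1\<^sub>m m) (fm_D F) + kron (1\<^sub>m m) (fm_C F) * Q * ?B"
    unfolding fm_eval_def chain_blockwise_sum[where Y = Y and w = w, OF Y w linear(2)] mat_inv_eqI[OF Q] ..
  also have "kron (1\<^sub>m m) (fm_C F) * Q * ?B = kron (1\<^sub>m m) (fm_C F) * ?W"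
    unfolding QB[symmetric] by (rule assoc_mult_mat[OF Cc Qc(1) blockmat_carrier])
  also have "\<dots> = blockmat s s m (\<lambda>i j. fm_C F * chain_state w i j)"
    by (rule kron_one_mult_blockmat[OF carriers(2) Wc])
  also have "kron (1\<^sub>m m) (fm_D F) + \<dots> =
      blockmat s s m (\<lambda>i j. (if i = j then fm_D F else 0\<^sub>m s s) + fm_C F * chain_state w i j)"
    unfolding kron_one_eq_blockmat[OF carriers(1)]
    by (rule blockmat_add) (use mult_carrier_mat[OF carriers(2) Wc] in auto)
  finally show ?thesis .
qed

end

lemma blockmat_eqD:
  assumes "blockmat p q m F = blockmat p q m G" "i < m" "j < m"
    and "F i j \<in> carrier_mat p q" "G i j \<in> carrier_mat p q"
  shows "F i j = G i j"
proof (rule eq_matI)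
  fix a b assume "a < dim_row (G i j)" "b < dim_col (G i j)"
  then have ab: "a < p" "b < q" using assms by auto
  show "F i j $$ (a, b) = G i j $$ (a, b)"
    using assms(1) blockmat_index[OF assms(2,3) ab, of F] blockmat_index[OF assms(2,3) ab, of G] by simp
qed (use assms in auto)

text \<open>Both realizations reproduce the common value of the expressions at one chain point built
  from \<open>u\<close> and \<open>(k, X)\<close>. A diagonal block of that value shows
  \<open>D\<close>, the top right block shows the moment.\<close>

lemma moments_eq:
  fixes R1 R2 :: "('d::finite, 'k::field) nc_rat"
  assumes "fm_realization s F1" "fm_realization s F2"
    and Y: "\<And>k. Y k \<in> carrier_mat s s"
    and R: "admits_realization R1 s Y F1" "admits_realization R2 s Y F2"
    and equiv: "nc_eval_equiv R1 R2" and "s \<ge> 1"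
    and u: "snd ` set u \<subseteq> carrier_mat s s" and X: "X \<in> carrier_mat s s"
  shows "fm_D F1 = fm_D F2"
    and "fm_C F1 * (fm_word F1 u * fm_B F1 k X) = fm_C F2 * (fm_word F2 u * fm_B F2 k X)"
proof -
  interpret F1: fm_real_fin s F1 by unfold_locales fact
  interpret F2: fm_real_fin s F2 by unfold_locales fact
  let ?l = "length u"
  \<comment> \<open>The path runs through \<open>?l\<close> letters and one final input step, so it
    crosses \<open>?l + 1\<close> superdiagonal blocks and visits \<open>?l + 2\<close> block
    rows.\<close>
  define m where "m = Suc (Suc ?l)"
  \<comment> \<open>Positions past the end repeat the last letter, so that every value of
    \<open>w\<close> has the size that the chain lemmas require for all \<open>i\<close>.\<close>
  define w where "w i = (u @ [(k, X)]) ! min i ?l" for i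
  have w: "snd (w i) \<in> carrier_mat s s" for i
  proof -
    have "w i \<in> set (u @ [(k, X)])" unfolding w_def by (rule nth_mem) simp
    then show ?thesis using u X by auto
  qed
  have m: "m \<ge> 1" by (simp add: m_def)
  let ?Z = "chain_point s Y w m"
  have Z: "?Z \<in> nc_dom (s * m) R1" "?Z \<in> nc_dom (s * m) R2"
    using R m w by (auto intro!: chain_point_in_nc_dom simp: admits_realization_def)
  have "s * m \<ge> 1" using \<open>s \<ge> 1\<close> m by simp
  then have "nc_eval (s * m) ?Z R1 = nc_eval (s * m) ?Z R2"
    using equiv Z unfolding nc_eval_equiv_def by blast
  then have "fm_eval s Y F1 m ?Z = fm_eval s Y F2 m ?Z"
    using R m Z unfolding admits_realization_def by metis
  moreover have "?Z \<in> fm_DOM s Y F1 m" "?Z \<in> fm_DOM s Y F2 m"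
    using R m Z unfolding admits_realization_def by blast+
  ultimately have eq: "blockmat s s m (\<lambda>i j. (if i = j then fm_D F1 else 0\<^sub>m s s) + fm_C F1 * F1.chain_state w i j) =
      blockmat s s m (\<lambda>i j. (if i = j then fm_D F2 else 0\<^sub>m s s) + fm_C F2 * F2.chain_state w i j)"
    by (simp only: F1.fm_eval_chain_point[of Y w, OF Y w] F2.fm_eval_chain_point[of Y w, OF Y w])
  have c1: "fm_C F1 * F1.chain_state w i j \<in> carrier_mat s s" for i j
    by (rule mult_carrier_mat[OF F1.carriers(2) F1.chain_state_carrier[of w, OF w]])
  have c2: "fm_C F2 * F2.chain_state w i j \<in> carrier_mat s s" for i j
    by (rule mult_carrier_mat[OF F2.carriers(2) F2.chain_state_carrier[of w, OF w]])
  have blocks: "(if i = j then fm_D F1 else 0\<^sub>m s s) + fm_C F1 * F1.chain_state w i j =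
      (if i = j then fm_D F2 else 0\<^sub>m s s) + fm_C F2 * F2.chain_state w i j" if "i < m" "j < m" for i j
    by (rule blockmat_eqD[OF eq that]) (use c1[of i j] c2[of i j] in auto)
  show "fm_D F1 = fm_D F2"
    using blocks[of 0 0] right_mult_zero_mat[OF F1.carriers(2)] right_mult_zero_mat[OF F2.carriers(2)]
    by (simp add: m_def F1.chain_state_def F2.chain_state_def)
  have "map w [0..<?l] = u" by (rule nth_equalityI) (auto simp: w_def nth_append)
  moreover have "w ?l = (k, X)" by (simp add: w_def)
  ultimately show "fm_C F1 * (fm_word F1 u * fm_B F1 k X) = fm_C F2 * (fm_word F2 u * fm_B F2 k X)"
    using blocks[of 0 "Suc ?l"] c1[of 0 "Suc ?l"] c2[of 0 "Suc ?l"]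
    by (simp add: m_def F1.chain_state_def F2.chain_state_def)
qed

section \<open>A linear relation between the two state spaces and the similarity that it
  carries\<close>

section \<open>The state space isomorphism\<close>

text \<open>Partners are chosen for the unit vectors alone; linearity of the relation extends the
  choice to all vectors, even where a vector has several partners.\<close>

lemma matrix_of_linear_relation:
  fixes P :: "'k::field vec \<Rightarrow> 'k vec \<Rightarrow> bool"
  assumes zero: "P (0\<^sub>v n) (0\<^sub>v p)"
    and add: "\<And>x y x' y'. P x y \<Longrightarrow> P x' y' \<Longrightarrow> P (x + x') (y + y')"
    and smult: "\<And>x y c. P x y \<Longrightarrow> P (c \<cdot>\<^sub>v x) (c \<cdot>\<^sub>v y)"
    and total: "\<And>x. x \<in> carrier_vec n \<Longrightarrow> \<exists>y\<in>carrier_vec p. P x y"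
  obtains T where "T \<in> carrier_mat p n" "\<And>x. x \<in> carrier_vec n \<Longrightarrow> P x (T *\<^sub>v x)"
proof -
  have "\<forall>i. \<exists>y. y \<in> carrier_vec p \<and> P (unit_vec n i) y" using total[OF unit_vec_carrier] by blast
  then obtain y where y: "\<And>i. y i \<in> carrier_vec p" "\<And>i. P (unit_vec n i) (y i)" by metis
  define T where "T = mat p n (\<lambda>(r, i). y i $ r)"
  have "P x (T *\<^sub>v x)" if x: "x \<in> carrier_vec n" for x
  proof -
    \<comment> \<open>Truncation to the first \<open>j\<close> coordinates makes each induction step
      one use of \<open>add\<close> and one of \<open>smult\<close>.\<close>
    have "P (vec n (\<lambda>i. if i < j then x $ i else 0)) (vec p (\<lambda>r. \<Sum>i<j. y i $ r * x $ i))" if "j \<le> n" for j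
      using that
    proof (induction j)
      case 0
      have "vec n (\<lambda>i. if i < 0 then x $ i else 0) = 0\<^sub>v n" "vec p (\<lambda>r. \<Sum>i<0. y i $ r * x $ i) = 0\<^sub>v p"
        by auto
      then show ?case using zero by simp
    next
      case (Suc j)
      have "vec n (\<lambda>i. if i < Suc j then x $ i else 0) =
          vec n (\<lambda>i. if i < j then x $ i else 0) + x $ j \<cdot>\<^sub>v unit_vec n j"
        using Suc.prems by (intro eq_vecI) (auto simp: less_Suc_eq)
      moreover have "vec p (\<lambda>r. \<Sum>i<Suc j. y i $ r * x $ i) =
          vec p (\<lambda>r. \<Sum>i<j. y i $ r * x $ i) + x $ j \<cdot>\<^sub>v y j"
        using y(1)[of j] by (intro eq_vecI) auto
      ultimately show ?case using Suc add smult y(2) by simp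
    qed
    from this[of n] have "P (vec n (\<lambda>i. if i < n then x $ i else 0)) (vec p (\<lambda>r. \<Sum>i<n. y i $ r * x $ i))"
      by simp
    moreover have "vec n (\<lambda>i. if i < n then x $ i else 0) = x" using x by (intro eq_vecI) auto
    moreover have "vec p (\<lambda>r. \<Sum>i<n. y i $ r * x $ i) = T *\<^sub>v x"
      using x by (intro eq_vecI) (auto simp: T_def scalar_prod_def lessThan_atLeast0)
    ultimately show ?thesis by simp
  qed
  moreover have "T \<in> carrier_mat p n" by (simp add: T_def)
  ultimately show thesis using that by blast
qed

context fm_real
begin

definition reach :: "('d \<times> 'k mat) list \<Rightarrow> 'd \<Rightarrow> 'k mat \<Rightarrow> 'k vec \<Rightarrow> 'k vec" where
  "reach w k X u = (fm_word F w * fm_B F k X) *\<^sub>v u"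

lemma reach_carrier [simp]:
  assumes "snd ` set w \<subseteq> carrier_mat s s" "X \<in> carrier_mat s s" "u \<in> carrier_vec s"
  shows "reach w k X u \<in> carrier_vec L"
  unfolding reach_def
  by (rule mult_mat_vec_carrier[OF mult_carrier_mat[OF fm_word_carrier carriers(4)]]) (use assms in auto)

lemma A_reach:
  assumes "snd ` set w \<subseteq> carrier_mat s s" "X \<in> carrier_mat s s" "u \<in> carrier_vec s" "Z \<in> carrier_mat s s"
  shows "fm_A F i Z *\<^sub>v reach w k X u = reach ((i, Z) # w) k X u"
proof -
  note c = carriers(3)[OF assms(4)] fm_word_carrier[OF assms(1)] carriers(4)[OF assms(2)]
  show ?thesis unfolding reach_def fm_word_simps assoc_mult_mat[OF c]
    by (rule assoc_mult_mat_vec[OF c(1) mult_carrier_mat[OF c(2,3)] assms(3), symmetric])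
qed

lemma C_reach:
  assumes "snd ` set w \<subseteq> carrier_mat s s" "X \<in> carrier_mat s s" "u \<in> carrier_vec s"
  shows "fm_C F *\<^sub>v reach w k X u = (fm_C F * (fm_word F w * fm_B F k X)) *\<^sub>v u"
  unfolding reach_def
  by (rule assoc_mult_mat_vec[OF carriers(2) mult_carrier_mat[OF fm_word_carrier carriers(4)], symmetric])
    (use assms in auto)

end

locale fm_pair = F: fm_real s F + G: fm_real s G
  for s :: nat and F G :: "('d, 'k::field) fm" +
  assumes moments: "\<And>w k X. snd ` set w \<subseteq> carrier_mat s s \<Longrightarrow> X \<in> carrier_mat s s \<Longrightarrow>
    fm_C F * (fm_word F w * fm_B F k X) = fm_C G * (fm_word G w * fm_B G k X)"
begin

text \<open>In the controllable and observable case this relation is the graph of the similarity.\<close>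

inductive rel :: "'k vec \<Rightarrow> 'k vec \<Rightarrow> bool" where
  rel_zero: "rel (0\<^sub>v (fm_L F)) (0\<^sub>v (fm_L G))"
| rel_step: "rel x y \<Longrightarrow> snd ` set w \<subseteq> carrier_mat s s \<Longrightarrow> X \<in> carrier_mat s s \<Longrightarrow> u \<in> carrier_vec s \<Longrightarrow>
    rel (x + c \<cdot>\<^sub>v F.reach w k X u) (y + c \<cdot>\<^sub>v G.reach w k X u)"

lemma rel_carrier: "rel x y \<Longrightarrow> x \<in> carrier_vec (fm_L F) \<and> y \<in> carrier_vec (fm_L G)"
  by (induction rule: rel.induct) auto

lemma rel_add:
  assumes "rel x' y'" "rel x y"
  shows "rel (x + x') (y + y')"
  using assms
proof (induction rule: rel.induct)
  case rel_zero
  then show ?case using rel_carrier by fastforce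
next
  case (rel_step x' y' w X u c k)
  have c: "c \<cdot>\<^sub>v F.reach w k X u \<in> carrier_vec (fm_L F)" "c \<cdot>\<^sub>v G.reach w k X u \<in> carrier_vec (fm_L G)"
    using rel_step by auto
  have xy: "x \<in> carrier_vec (fm_L F)" "y \<in> carrier_vec (fm_L G)"
    "x' \<in> carrier_vec (fm_L F)" "y' \<in> carrier_vec (fm_L G)"
    using rel_carrier rel_step by auto
  show ?case
    unfolding assoc_add_vec[OF xy(1,3) c(1), symmetric] assoc_add_vec[OF xy(2,4) c(2), symmetric]
    using rel_step by (intro rel.rel_step) auto
qed

lemma rel_reach:
  assumes "snd ` set w \<subseteq> carrier_mat s s" "X \<in> carrier_mat s s" "u \<in> carrier_vec s"
  shows "rel (F.reach w k X u) (G.reach w k X u)"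
  using rel_step[OF rel_zero assms, of 1 k] assms by simp

lemma rel_smult: "rel x y \<Longrightarrow> rel (a \<cdot>\<^sub>v x) (a \<cdot>\<^sub>v y)"
proof (induction rule: rel.induct)
  case rel_zero
  have "a \<cdot>\<^sub>v 0\<^sub>v n = (0\<^sub>v n :: 'k vec)" for n by auto
  then show ?case using rel.rel_zero by simp
next
  case (rel_step x y w X u c k)
  have "a \<cdot>\<^sub>v (x + c \<cdot>\<^sub>v F.reach w k X u) = a \<cdot>\<^sub>v x + (a * c) \<cdot>\<^sub>v F.reach w k X u"
    using rel_step rel_carrier[OF rel_step(1)]
    by (simp add: smult_add_distrib_vec[of _ "fm_L F"] smult_smult_assoc)
  moreover have "a \<cdot>\<^sub>v (y + c \<cdot>\<^sub>v G.reach w k X u) = a \<cdot>\<^sub>v y + (a * c) \<cdot>\<^sub>v G.reach w k X u"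
    using rel_step rel_carrier[OF rel_step(1)]
    by (simp add: smult_add_distrib_vec[of _ "fm_L G"] smult_smult_assoc)
  ultimately show ?case using rel_step by (simp add: rel.rel_step)
qed

lemma mult_mat_vec_step:
  fixes M :: "'k mat"
  assumes "M \<in> carrier_mat p n" "x \<in> carrier_vec n" "r \<in> carrier_vec n"
  shows "M *\<^sub>v (x + c \<cdot>\<^sub>v r) = M *\<^sub>v x + c \<cdot>\<^sub>v (M *\<^sub>v r)"
  using assms by (simp add: mult_add_distrib_mat_vec mult_mat_vec)

text \<open>Applying \<open>A\<close> to a paired generator lengthens its word by the same letter on
  both sides, so the generating pairs are permuted into one another.\<close>

lemma rel_A:
  assumes "rel x y" and Z: "Z \<in> carrier_mat s s"
  shows "rel (fm_A F i Z *\<^sub>v x) (fm_A G i Z *\<^sub>v y)"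
  using assms(1)
proof (induction rule: rel.induct)
  case rel_zero
  have "M *\<^sub>v 0\<^sub>v n = 0\<^sub>v n" if "M \<in> carrier_mat n n" for n and M :: "'k mat"
    using that by (intro eq_vecI) auto
  then show ?case using rel.rel_zero Z by simp
next
  case (rel_step x y w X u c k)
  have xy: "x \<in> carrier_vec (fm_L F)" "y \<in> carrier_vec (fm_L G)" using rel_carrier rel_step by auto
  have "snd ` set ((i, Z) # w) \<subseteq> carrier_mat s s" using rel_step Z by auto
  from rel.rel_step[OF rel_step.IH this rel_step(3,4), of c k] show ?case
    unfolding mult_mat_vec_step[OF F.carriers(3)[OF Z] xy(1) F.reach_carrier[OF rel_step(2-4)]]
      mult_mat_vec_step[OF G.carriers(3)[OF Z] xy(2) G.reach_carrier[OF rel_step(2-4)]]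
      F.A_reach[OF rel_step(2-4) Z] G.A_reach[OF rel_step(2-4) Z] .
qed

text \<open>Equality of the moments enters here: it says that the output maps agree on each
  generating pair.\<close>

lemma rel_C: "rel x y \<Longrightarrow> fm_C F *\<^sub>v x = fm_C G *\<^sub>v y"
proof (induction rule: rel.induct)
  case rel_zero
  have "M *\<^sub>v 0\<^sub>v n = 0\<^sub>v s" if "M \<in> carrier_mat s n" for n and M :: "'k mat"
    using that by (intro eq_vecI) auto
  then show ?case by simp
next
  case (rel_step x y w X u c k)
  have xy: "x \<in> carrier_vec (fm_L F)" "y \<in> carrier_vec (fm_L G)" using rel_carrier rel_step by auto
  show ?case
    unfolding mult_mat_vec_step[OF F.carriers(2) xy(1) F.reach_carrier[OF rel_step(2-4)]]
      mult_mat_vec_step[OF G.carriers(2) xy(2) G.reach_carrier[OF rel_step(2-4)]]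
      F.C_reach[OF rel_step(2-4)] G.C_reach[OF rel_step(2-4)] moments[OF rel_step(2,3)] rel_step.IH ..
qed

lemma rel_word:
  assumes "rel x y" "snd ` set w \<subseteq> carrier_mat s s"
  shows "rel (fm_word F w *\<^sub>v x) (fm_word G w *\<^sub>v y)"
  using assms(2)
proof (induction w)
  case Nil
  then show ?case using assms(1) rel_carrier by fastforce
next
  case (Cons a w)
  obtain k X where a: "a = (k, X)" by (cases a)
  with Cons have X: "X \<in> carrier_mat s s" and w: "snd ` set w \<subseteq> carrier_mat s s" by auto
  have xy: "x \<in> carrier_vec (fm_L F)" "y \<in> carrier_vec (fm_L G)" using rel_carrier[OF assms(1)] by auto
  from rel_A[OF Cons.IH[OF w] X, of k] show ?case
    unfolding a fm_word_simps assoc_mult_mat_vec[OF F.carriers(3)[OF X] F.fm_word_carrier[OF w] xy(1)]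
      assoc_mult_mat_vec[OF G.carriers(3)[OF X] G.fm_word_carrier[OF w] xy(2)] .
qed

text \<open>The difference \<open>z\<close> of two partners is related to zero. By
  \<open>rel_word\<close> and \<open>rel_C\<close> all its outputs equal outputs of zero, and
  observability of \<open>G\<close> kills it.\<close>

lemma rel_right_unique:
  assumes obs: "fm_observable s G" and "rel x y" "rel x y'"
  shows "y = y'"
proof -
  have xy: "x \<in> carrier_vec (fm_L F)" "y \<in> carrier_vec (fm_L G)" "y' \<in> carrier_vec (fm_L G)"
    using assms rel_carrier by auto
  define z where "z = y + (- 1) \<cdot>\<^sub>v y'"
  have z: "z \<in> carrier_vec (fm_L G)" using xy by (simp add: z_def)
  have "x + (- 1) \<cdot>\<^sub>v x = 0\<^sub>v (fm_L F)" using xy by (intro eq_vecI) auto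
  then have rz: "rel (0\<^sub>v (fm_L F)) z"
    using rel_add[OF rel_smult[OF assms(3), of "- 1"] assms(2)] by (simp add: z_def)
  have "(fm_C G * fm_word G w) *\<^sub>v z = 0\<^sub>v s" if w: "snd ` set w \<subseteq> carrier_mat s s" for w
  proof -
    have "(fm_C G * fm_word G w) *\<^sub>v z = fm_C G *\<^sub>v (fm_word G w *\<^sub>v z)"
      by (rule assoc_mult_mat_vec[OF G.carriers(2) G.fm_word_carrier[OF w] z])
    also have "\<dots> = fm_C F *\<^sub>v (fm_word F w *\<^sub>v 0\<^sub>v (fm_L F))"
      using rel_C[OF rel_word[OF rz w]] by simp
    also have "\<dots> = 0\<^sub>v s"
    proof -
      have "M *\<^sub>v 0\<^sub>v n = 0\<^sub>v m" if "M \<in> carrier_mat m n" for m n and M :: "'k mat"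
        using that by (intro eq_vecI) auto
      then show ?thesis using F.fm_word_carrier[OF w] F.carriers(2) by simp
    qed
    finally show ?thesis .
  qed
  then have "z = 0\<^sub>v (fm_L G)" using obs z unfolding fm_observable_def by blast
  then have "z $ i = 0" if "i < fm_L G" for i using that by simp
  then show ?thesis using xy by (intro eq_vecI) (auto simp: z_def)
qed

text \<open>The vectors that possess a partner form a submodule containing the generators, hence
  their span.\<close>

lemma rel_left_total:
  assumes "fm_controllable s F" "x \<in> carrier_vec (fm_L F)"
  shows "\<exists>y. rel x y"
proof -
  let ?N = "{x. \<exists>y. rel x y}"
  have "submodule class_ring ?N (module_vec TYPE('k) (fm_L F))"
    unfolding submodule_def using vec_module rel_carrier rel_add rel_zero rel_smult
    by (auto simp: module_vec_simps) blast+
  moreover have "{(fm_word F w * fm_B F k X) *\<^sub>v u | w k X u.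
      snd ` set w \<subseteq> carrier_mat s s \<and> X \<in> carrier_mat s s \<and> u \<in> carrier_vec s} \<subseteq> ?N"
    unfolding F.reach_def[symmetric] using rel_reach by blast
  ultimately have "LinearCombinations.module.span class_ring (module_vec TYPE('k) (fm_L F))
      {(fm_word F w * fm_B F k X) *\<^sub>v u | w k X u.
        snd ` set w \<subseteq> carrier_mat s s \<and> X \<in> carrier_mat s s \<and> u \<in> carrier_vec s} \<subseteq> ?N"
    by (intro module.span_is_subset[OF vec_module])
  then show ?thesis using assms unfolding fm_controllable_def by auto
qed

text \<open>The hypotheses are symmetric, so every fact about \<open>rel\<close> also holds with
  \<open>F\<close> and \<open>G\<close> exchanged; this supplies left uniqueness and right
  totality.\<close>

lemma converse_pair: "fm_pair s G F"
  by unfold_locales (simp add: moments)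

lemma rel_converse: "fm_pair.rel s G F y x \<Longrightarrow> rel x y"
proof -
  interpret C: fm_pair s G F by (rule converse_pair)
  show "C.rel y x \<Longrightarrow> rel x y"
    by (induction rule: C.rel.induct) (auto intro: rel.intros)
qed

text \<open>Any similarity intertwines the words of the two realizations and therefore maps each
  generator to its partner. Together with totality of \<open>rel\<close> this makes the similarity
  unique.\<close>

lemma similarity_rel:
  assumes S: "fm_similarity s F G S" and LL: "fm_L F = fm_L G" and "rel x y"
  shows "S *\<^sub>v x = y"
proof -
  let ?n = "fm_L F"
  have Sc: "S \<in> carrier_mat ?n ?n" and inv: "invertible_mat S"
    and B: "\<And>k X. X \<in> carrier_mat s s \<Longrightarrow> fm_B G k X = S * fm_B F k X"
    and A: "\<And>k X. X \<in> carrier_mat s s \<Longrightarrow> fm_A G k X = S * fm_A F k X * mat_inv S"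
    using S by (auto simp: fm_similarity_def)
  obtain S' where S': "is_mat_inverse S S'" using inv invertible_mat_iff_is_mat_inverse by blast
  then have S'c: "S' \<in> carrier_mat ?n ?n" "S' * S = 1\<^sub>m ?n" "mat_inv S = S'"
    using Sc mat_inv_eqI[OF S'] by (auto simp: is_mat_inverse_def)
  \<comment> \<open>Conjugation in its intertwining form, which is what propagates along a
    word.\<close>
  have AS: "fm_A G k X * (S * M) = S * (fm_A F k X * M)"
    if X: "X \<in> carrier_mat s s" and M: "M \<in> carrier_mat ?n s" for k X M
    unfolding A[OF X] S'c(3)
      mult_cancel_mid_mat[OF mult_carrier_mat[OF Sc F.carriers(3)[OF X]] S'c(1) Sc M S'c(2)]
    by (rule assoc_mult_mat[OF Sc F.carriers(3)[OF X] M])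
  have W: "S * (fm_word F w * M) = fm_word G w * (S * M)"
    if "snd ` set w \<subseteq> carrier_mat s s" and M: "M \<in> carrier_mat ?n s" for w M
    using that(1)
  proof (induction w)
    case Nil
    have "S * M \<in> carrier_mat (fm_L G) s" using Sc M LL by simp
    then show ?case using M by (simp add: left_mult_one_mat[of _ "fm_L G" s] left_mult_one_mat[of _ ?n s])
  next
    case (Cons a w)
    obtain k X where a: "a = (k, X)" by (cases a)
    with Cons have X: "X \<in> carrier_mat s s" and w: "snd ` set w \<subseteq> carrier_mat s s" by auto
    have SM: "S * M \<in> carrier_mat (fm_L G) s" using Sc M LL by simp
    have "S * (fm_word F (a # w) * M) = S * (fm_A F k X * (fm_word F w * M))"
      unfolding a fm_word_simps assoc_mult_mat[OF F.carriers(3)[OF X] F.fm_word_carrier[OF w] M] ..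
    also have "\<dots> = fm_A G k X * (S * (fm_word F w * M))"
      by (rule AS[OF X mult_carrier_mat[OF F.fm_word_carrier[OF w] M], symmetric])
    also have "\<dots> = fm_A G k X * (fm_word G w * (S * M))" unfolding Cons.IH[OF w] ..
    also have "\<dots> = fm_word G (a # w) * (S * M)"
      unfolding a fm_word_simps assoc_mult_mat[OF G.carriers(3)[OF X] G.fm_word_carrier[OF w] SM] ..
    finally show ?case .
  qed
  from \<open>rel x y\<close> show ?thesis
  proof (induction rule: rel.induct)
    case rel_zero
    then show ?case using Sc LL by (intro eq_vecI) auto
  next
    case (rel_step x y w X u c k)
    have x: "x \<in> carrier_vec ?n" using rel_carrier rel_step by auto
    note FB = F.carriers(4)[OF rel_step(3)]
    have "S *\<^sub>v F.reach w k X u = (S * (fm_word F w * fm_B F k X)) *\<^sub>v u"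
      unfolding F.reach_def
      by (rule assoc_mult_mat_vec[OF Sc mult_carrier_mat[OF F.fm_word_carrier[OF rel_step(2)] FB] rel_step(4), symmetric])
    also have "\<dots> = G.reach w k X u"
      unfolding W[OF rel_step(2) FB] B[OF rel_step(3), symmetric] G.reach_def ..
    finally show ?case
      unfolding mult_mat_vec_step[OF Sc x F.reach_carrier[OF rel_step(2-4)]] rel_step.IH by simp
  qed
qed

theorem unique_similarity:
  assumes contr: "fm_controllable s F" "fm_controllable s G"
    and obs: "fm_observable s F" "fm_observable s G"
  shows "fm_L F = fm_L G" and "\<exists>!T. fm_similarity s F G T"
proof -
  interpret C: fm_pair s G F by (rule converse_pair)
  let ?n = "fm_L F" and ?p = "fm_L G"
  \<comment> \<open>\<open>T\<close> picks a partner for every state of \<open>F\<close>, and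
    \<open>T'\<close> one for every state of \<open>G\<close>; each choice rests on controllability
    of the source.\<close>
  obtain T where T: "T \<in> carrier_mat ?p ?n" "\<And>x. x \<in> carrier_vec ?n \<Longrightarrow> rel x (T *\<^sub>v x)"
    by (rule matrix_of_linear_relation[of rel ?n ?p])
      (use rel_zero rel_add rel_smult rel_left_total[OF contr(1)] rel_carrier in blast)+
  obtain T' where T': "T' \<in> carrier_mat ?n ?p" "\<And>y. y \<in> carrier_vec ?p \<Longrightarrow> C.rel y (T' *\<^sub>v y)"
    by (rule matrix_of_linear_relation[of C.rel ?p ?n])
      (use C.rel_zero C.rel_add C.rel_smult C.rel_left_total[OF contr(2)] C.rel_carrier in blast)+
  have relT': "rel (T' *\<^sub>v y) y" if "y \<in> carrier_vec ?p" for y using T'(2)[OF that] rel_converse by blast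
  \<comment> \<open>Both \<open>y\<close> and its image under \<open>T * T'\<close> are partners of
    the image of \<open>y\<close> under \<open>T'\<close>, so observability of \<open>G\<close>
    identifies them. For \<open>T' * T\<close> the roles are exchanged and observability of
    \<open>F\<close> is used.\<close>
  have TT': "T * T' = 1\<^sub>m ?p"
  proof (rule mult_unit_vec_eqI)
    fix y :: "'k vec" assume y: "y \<in> carrier_vec ?p"
    then have "rel (T' *\<^sub>v y) (T *\<^sub>v (T' *\<^sub>v y))" using T T' by auto
    then have "T *\<^sub>v (T' *\<^sub>v y) = y" using relT'[OF y] rel_right_unique[OF obs(2)] by blast
    then show "(T * T') *\<^sub>v y = 1\<^sub>m ?p *\<^sub>v y" using T T' y by simp
  qed (use T T' in auto)
  have T'T: "T' * T = 1\<^sub>m ?n"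
  proof (rule mult_unit_vec_eqI)
    fix x :: "'k vec" assume x: "x \<in> carrier_vec ?n"
    then have Tx: "T *\<^sub>v x \<in> carrier_vec ?p" using T by simp
    have "C.rel (T *\<^sub>v x) x" using fm_pair.rel_converse[OF converse_pair] T(2)[OF x] by blast
    then have "T' *\<^sub>v (T *\<^sub>v x) = x" using T'(2)[OF Tx] C.rel_right_unique[OF obs(1)] by blast
    then show "(T' * T) *\<^sub>v x = 1\<^sub>m ?n *\<^sub>v x" using T T' x by simp
  qed (use T T' in auto)
  show LL: "fm_L F = fm_L G"
    using left_inverse_mat_dim_le[OF T(1) T'(1) T'T] left_inverse_mat_dim_le[OF T'(1) T(1) TT'] by simp
  have Tn: "T \<in> carrier_mat ?n ?n" "T' \<in> carrier_mat ?n ?n" using T T' LL by auto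
  have inv: "is_mat_inverse T T'" unfolding is_mat_inverse_def using Tn TT' T'T LL by auto
  note mi = mat_inv_eqI[OF inv]
  have CT: "fm_C F = fm_C G * T"
  proof (rule mult_unit_vec_eqI)
    fix x :: "'k vec" assume x: "x \<in> carrier_vec ?n"
    then show "fm_C F *\<^sub>v x = (fm_C G * T) *\<^sub>v x"
      using rel_C[OF T(2)[OF x]] assoc_mult_mat_vec[OF G.carriers(2) T(1) x] by simp
  qed (use T mult_carrier_mat[OF G.carriers(2) T(1)] in auto)
  have C': "fm_C G = fm_C F * T'"
    unfolding CT assoc_mult_mat[OF G.carriers(2) T(1) T'(1)] TT'
    by (rule right_mult_one_mat[OF G.carriers(2), symmetric])
  have B': "fm_B G k X = T * fm_B F k X" if X: "X \<in> carrier_mat s s" for k X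
  proof (rule mult_unit_vec_eqI)
    fix u :: "'k vec" assume u: "u \<in> carrier_vec s"
    \<comment> \<open>This pair is the generator with the empty word.\<close>
    have "rel (fm_B F k X *\<^sub>v u) (fm_B G k X *\<^sub>v u)"
      using rel_reach[of "[]", OF _ X u, of k] X
      by (simp add: F.reach_def G.reach_def left_mult_one_mat[OF F.carriers(4)] left_mult_one_mat[OF G.carriers(4)])
    moreover have "rel (fm_B F k X *\<^sub>v u) (T *\<^sub>v (fm_B F k X *\<^sub>v u))"
      by (rule T(2)[OF mult_mat_vec_carrier[OF F.carriers(4)[OF X] u]])
    ultimately have "fm_B G k X *\<^sub>v u = T *\<^sub>v (fm_B F k X *\<^sub>v u)" using rel_right_unique[OF obs(2)] by blast
    then show "fm_B G k X *\<^sub>v u = (T * fm_B F k X) *\<^sub>v u"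
      using assoc_mult_mat_vec[OF T(1) F.carriers(4)[OF X] u] by simp
  qed (rule G.carriers(4)[OF X], rule mult_carrier_mat[OF T(1) F.carriers(4)[OF X]])
  have A': "fm_A G k X = T * fm_A F k X * T'" if X: "X \<in> carrier_mat s s" for k X
  proof -
    note FA = F.carriers(3)[OF X, of k] and GA = G.carriers(3)[OF X, of k]
    \<comment> \<open>On a state \<open>x\<close>, both sides are partners of \<open>A\<close>
      applied to \<open>x\<close>: one by invariance of \<open>rel\<close>, the other by the choice
      of \<open>T\<close>.\<close>
    have "fm_A G k X * T = T * fm_A F k X"
    proof (rule mult_unit_vec_eqI)
      fix x :: "'k vec" assume x: "x \<in> carrier_vec ?n"
      have "rel (fm_A F k X *\<^sub>v x) (fm_A G k X *\<^sub>v (T *\<^sub>v x))" by (rule rel_A[OF T(2)[OF x] X])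
      moreover have "rel (fm_A F k X *\<^sub>v x) (T *\<^sub>v (fm_A F k X *\<^sub>v x))"
        by (rule T(2)[OF mult_mat_vec_carrier[OF FA x]])
      ultimately have "fm_A G k X *\<^sub>v (T *\<^sub>v x) = T *\<^sub>v (fm_A F k X *\<^sub>v x)"
        using rel_right_unique[OF obs(2)] by blast
      then show "(fm_A G k X * T) *\<^sub>v x = (T * fm_A F k X) *\<^sub>v x"
        unfolding assoc_mult_mat_vec[OF GA T(1) x] assoc_mult_mat_vec[OF T(1) FA x] .
    qed (rule mult_carrier_mat[OF GA T(1)], rule mult_carrier_mat[OF T(1) FA])
    then have "T * fm_A F k X * T' = fm_A G k X * T * T'" by simp
    also have "\<dots> = fm_A G k X" unfolding assoc_mult_mat[OF GA T(1) T'(1)] TT' by (rule right_mult_one_mat[OF GA])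
    finally show ?thesis by simp
  qed
  have "invertible_mat T" using inv invertible_mat_iff_is_mat_inverse by blast
  then have simT: "fm_similarity s F G T"
    unfolding fm_similarity_def mi using Tn C' B' A' by blast
  then show "\<exists>!T. fm_similarity s F G T"
  proof (rule ex1I)
    fix S assume S: "fm_similarity s F G S"
    show "S = T"
    proof (rule mult_unit_vec_eqI)
      fix x :: "'k vec" assume "x \<in> carrier_vec ?n"
      then show "S *\<^sub>v x = T *\<^sub>v x" using similarity_rel[OF S LL T(2)] by blast
    qed (use S Tn in \<open>auto simp: fm_similarity_def\<close>)
  qed
qed

end

section \<open>Conjugate pencils and the resulting equality of domains and values\<close>

section \<open>Similar realizations have the same values\<close>

lemma mult_mat_sum:
  fixes A :: "'a::semiring_0 mat"
  assumes "A \<in> carrier_mat p q" "\<And>k. M k \<in> carrier_mat q r"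
  shows "mat_sum p r (\<lambda>k. A * M k) S = A * mat_sum q r M S"
proof (rule eq_matI)
  fix a b assume "a < dim_row (A * mat_sum q r M S)" "b < dim_col (A * mat_sum q r M S)"
  then have ab: "a < p" "b < r" using assms by (auto simp: mat_sum_def)
  have "mat_sum p r (\<lambda>k. A * M k) S $$ (a, b) = (\<Sum>k\<in>S. \<Sum>c<q. A $$ (a, c) * M k $$ (c, b))"
    unfolding mat_sum_def index_mult_mat_sum[OF assms ab, symmetric] using ab by simp
  also have "\<dots> = (\<Sum>c<q. A $$ (a, c) * mat_sum q r M S $$ (c, b))"
    using ab by (subst sum.swap) (simp add: mat_sum_def sum_distrib_left)
  also have "\<dots> = (A * mat_sum q r M S) $$ (a, b)"
    by (rule index_mult_mat_sum[symmetric]) (use assms ab in auto)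
  finally show "mat_sum p r (\<lambda>k. A * M k) S $$ (a, b) = (A * mat_sum q r M S) $$ (a, b)" .
qed (use assms in \<open>auto simp: mat_sum_def\<close>)

lemma mat_sum_mult:
  fixes A :: "'a::semiring_0 mat"
  assumes "\<And>k. M k \<in> carrier_mat p q" "A \<in> carrier_mat q r"
  shows "mat_sum p r (\<lambda>k. M k * A) S = mat_sum p q M S * A"
proof (rule eq_matI)
  fix a b assume "a < dim_row (mat_sum p q M S * A)" "b < dim_col (mat_sum p q M S * A)"
  then have ab: "a < p" "b < r" using assms by (auto simp: mat_sum_def)
  have "mat_sum p r (\<lambda>k. M k * A) S $$ (a, b) = (\<Sum>k\<in>S. \<Sum>c<q. M k $$ (a, c) * A $$ (c, b))"
    unfolding mat_sum_def index_mult_mat_sum[OF assms ab, symmetric] using ab by simp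
  also have "\<dots> = (\<Sum>c<q. mat_sum p q M S $$ (a, c) * A $$ (c, b))"
    using ab by (subst sum.swap) (simp add: mat_sum_def sum_distrib_right)
  also have "\<dots> = (mat_sum p q M S * A) $$ (a, b)"
    by (rule index_mult_mat_sum[symmetric]) (use assms ab in auto)
  finally show "mat_sum p r (\<lambda>k. M k * A) S $$ (a, b) = (mat_sum p q M S * A) $$ (a, b)" .
qed (use assms in \<open>auto simp: mat_sum_def\<close>)

text \<open>Writing the identity as \<open>T * T'\<close> turns conjugate linear parts into
  conjugate pencils.\<close>

lemma one_minus_conj_mat:
  fixes S :: "'a::{ring, monoid_mult} mat"
  assumes T: "T \<in> carrier_mat n n" "T' \<in> carrier_mat n n" and S: "S \<in> carrier_mat n n"
    and TT': "T * T' = 1\<^sub>m n"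
  shows "1\<^sub>m n - T * S * T' = T * (1\<^sub>m n - S) * T'"
  unfolding mult_minus_distrib_mat[OF T(1) one_carrier_mat S] mult_one_mat_right[OF T(1)]
    minus_mult_distrib_mat[OF T(1) mult_carrier_mat[OF T(1) S] T(2)] TT' ..

lemma kron_one_mult:
  fixes A B :: "'k::semiring_1 mat"
  assumes "A \<in> carrier_mat p q" "B \<in> carrier_mat q r"
  shows "kron (1\<^sub>m m) A * kron (1\<^sub>m m) B = kron (1\<^sub>m m) (A * B)"
proof -
  have "kron (1\<^sub>m m) A * kron (1\<^sub>m m) B =
      blockmat p r m (\<lambda>i j. A * (if i = j then B else 0\<^sub>m q r))"
    unfolding kron_one_eq_blockmat[OF assms(2)]
    by (rule kron_one_mult_blockmat[OF assms(1)]) (use assms in auto)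
  also have "\<dots> = kron (1\<^sub>m m) (A * B)"
    unfolding kron_one_eq_blockmat[OF mult_carrier_mat[OF assms]]
    by (rule blockmat_cong) (use assms right_mult_zero_mat[OF assms(1)] in auto)
  finally show ?thesis .
qed

lemma kron_one_carrier [simp]:
  fixes A :: "'k::semiring_1 mat"
  shows "A \<in> carrier_mat p q \<Longrightarrow> kron (1\<^sub>m m) A \<in> carrier_mat (p * m) (q * m)"
  by (simp add: kron_one_eq_blockmat)

text \<open>The inverse \<open>T'\<close> is a parameter, so that its Kronecker and tensor
  extensions can be formed directly instead of through \<open>mat_inv\<close>.\<close>

locale fm_similar_pair = F: fm_real s F + G: fm_real s G
  for s :: nat and F G :: "('d::finite, 'k::field) fm" +
  fixes T T' :: "'k mat"
  assumes L_eq: "fm_L G = fm_L F" and D_eq: "fm_D G = fm_D F"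
    and T: "T \<in> carrier_mat (fm_L F) (fm_L F)" "T' \<in> carrier_mat (fm_L F) (fm_L F)"
    and inv: "T * T' = 1\<^sub>m (fm_L F)" "T' * T = 1\<^sub>m (fm_L F)"
    and C_eq: "fm_C G = fm_C F * T'"
    and B_eq: "\<And>k X. X \<in> carrier_mat s s \<Longrightarrow> fm_B G k X = T * fm_B F k X"
    and A_eq: "\<And>k X. X \<in> carrier_mat s s \<Longrightarrow> fm_A G k X = T * fm_A F k X * T'"
begin

abbreviation "n \<equiv> fm_L F"

lemma block_carrier [simp]: "block s X i j \<in> carrier_mat s s"
  by (simp add: block_def)

lemma kron_inv: "kron (1\<^sub>m m) T * kron (1\<^sub>m m) T' = 1\<^sub>m (n * m)"
  "kron (1\<^sub>m m) T' * kron (1\<^sub>m m) T = 1\<^sub>m (n * m)"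
  using T inv by (simp_all add: kron_one_mult one_mat_eq_kron)

text \<open>Every block of the linear part is conjugated by \<open>T\<close>, which is conjugation
  of the whole matrix by its Kronecker product with the identity.\<close>

lemma pencil_conj:
  "fm_pencil s Y G m X = kron (1\<^sub>m m) T * fm_pencil s Y F m X * kron (1\<^sub>m m) T'"
proof -
  let ?T = "kron (1\<^sub>m m) T" and ?T' = "kron (1\<^sub>m m) T'"
  let ?A = "\<lambda>F k. blockwise s m n n (fm_A F k) (X k - kron (1\<^sub>m m) (Y k))"
  have Tc: "?T \<in> carrier_mat (n * m) (n * m)" "?T' \<in> carrier_mat (n * m) (n * m)" using T by auto
  have Ac: "?A F k \<in> carrier_mat (n * m) (n * m)" for F :: "('d, 'k) fm" and k
    unfolding blockwise_eq_blockmat by simp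
  have "?A G k = ?T * ?A F k * ?T'" for k
  proof -
    let ?a = "\<lambda>i j. fm_A F k (block s (X k - kron (1\<^sub>m m) (Y k)) i j)"
    have "?T * ?A F k * ?T' = blockmat n n m (\<lambda>i j. T * ?a i j) * ?T'"
      unfolding blockwise_eq_blockmat by (subst kron_one_mult_blockmat[OF T(1)]) auto
    also have "\<dots> = blockmat n n m (\<lambda>i j. T * ?a i j * T')"
      by (rule blockmat_mult_kron_one[OF T(2)])
        (rule mult_carrier_mat[OF T(1) F.carriers(3)[OF block_carrier]])
    finally show ?thesis unfolding blockwise_eq_blockmat by (simp add: A_eq)
  qed
  then have "mat_sum (n * m) (n * m) (?A G) UNIV = mat_sum (n * m) (n * m) (\<lambda>k. ?T * ?A F k * ?T') UNIV"
    by simp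
  also have "\<dots> = ?T * mat_sum (n * m) (n * m) (?A F) UNIV * ?T'"
    by (simp only: mat_sum_mult[OF mult_carrier_mat[OF Tc(1) Ac] Tc(2)] mult_mat_sum[OF Tc(1) Ac])
  finally show ?thesis
    unfolding fm_pencil_def L_eq by (simp only: one_minus_conj_mat[OF Tc mat_sum_carrier kron_inv(1)])
qed

lemma pencil_carrier: "fm_pencil s Y F m X \<in> carrier_mat (n * m) (n * m)"
  unfolding fm_pencil_def by (rule minus_carrier_mat) simp

lemma DOM_eq: "fm_DOM s Y G m = fm_DOM s Y F m"
proof -
  have T: "kron (1\<^sub>m m) T \<in> carrier_mat (n * m) (n * m)" "kron (1\<^sub>m m) T' \<in> carrier_mat (n * m) (n * m)"
    using T by auto
  have "det (fm_pencil s Y G m X) \<noteq> 0 \<longleftrightarrow> det (fm_pencil s Y F m X) \<noteq> 0" for X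
    unfolding pencil_conj det_nonzero_iff_is_mat_inverse[OF pencil_carrier]
      det_nonzero_iff_is_mat_inverse[OF mult_carrier_mat[OF mult_carrier_mat[OF T(1) pencil_carrier] T(2)]]
    by (rule mat_inverse_conj_iff[OF pencil_carrier T kron_inv])
  then show ?thesis unfolding fm_DOM_def by simp
qed

lemma eval_eq:
  assumes "X \<in> fm_DOM s Y F m"
  shows "fm_eval s Y G m X = fm_eval s Y F m X"
proof -
  let ?T = "kron (1\<^sub>m m) T" and ?T' = "kron (1\<^sub>m m) T'"
  let ?B = "\<lambda>F k. blockwise s m n s (fm_B F k) (X k - kron (1\<^sub>m m) (Y k))"
  have Tc: "?T \<in> carrier_mat (n * m) (n * m)" "?T' \<in> carrier_mat (n * m) (n * m)" using T by auto
  have Bc: "?B F k \<in> carrier_mat (n * m) (s * m)" for F :: "('d, 'k) fm" and k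
    unfolding blockwise_eq_blockmat by simp
  have "?B G k = ?T * ?B F k" for k
    unfolding blockwise_eq_blockmat by (subst kron_one_mult_blockmat[OF T(1)]) (auto simp: B_eq)
  then have B: "mat_sum (n * m) (s * m) (?B G) UNIV = ?T * mat_sum (n * m) (s * m) (?B F) UNIV"
    by (simp add: mult_mat_sum[OF Tc(1) Bc])
  have C: "kron (1\<^sub>m m) (fm_C G) = kron (1\<^sub>m m) (fm_C F) * ?T'"
    unfolding C_eq by (rule kron_one_mult[OF F.carriers(2) T(2), symmetric])
  have "\<exists>Q. is_mat_inverse (fm_pencil s Y F m X) Q"
    using assms by (simp add: fm_DOM_def det_nonzero_iff_is_mat_inverse[OF pencil_carrier])
  note transfer = transfer_conj[OF pencil_carrier Tc kron_inv kron_one_carrier[OF F.carriers(2)] mat_sum_carrier this]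
  show ?thesis unfolding fm_eval_def D_eq L_eq B C pencil_conj transfer ..
qed

end

section \<open>Extension of linear maps to matrices over a unital algebra\<close>

context unital_algebra
begin

lemma tensor_carrier [simp]: "A \<in> carrier_mat p q \<Longrightarrow> mat_tensor scale A a \<in> carrier_mat p q"
  by (simp add: mat_tensor_def)

lemma tensor_one: "mat_tensor scale (1\<^sub>m p) 1 = 1\<^sub>m p"
  by (rule eq_matI) (auto simp: mat_tensor_def)

text \<open>Scalar multiples of \<open>1\<close> act by scaling from either side; this keeps the
  noncommutativity of the algebra out of the conjugation argument.\<close>

lemma scale_one_mult: "scale a 1 * scale b x = scale (a * b) x" "scale b x * scale a 1 = scale (b * a) x"
  by (simp_all add: scale_mult_left scale_mult_right mult.commute)

lemma tensor_mult:
  assumes "A \<in> carrier_mat p q" "B \<in> carrier_mat q r"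
  shows "mat_tensor scale A 1 * mat_tensor scale B 1 = mat_tensor scale (A * B) 1"
proof (rule eq_matI)
  fix a b assume "a < dim_row (mat_tensor scale (A * B) 1)" "b < dim_col (mat_tensor scale (A * B) 1)"
  then have ab: "a < p" "b < r" using assms by (auto simp: mat_tensor_def)
  have "(mat_tensor scale A 1 * mat_tensor scale B 1) $$ (a, b) =
      (\<Sum>c<q. mat_tensor scale A 1 $$ (a, c) * mat_tensor scale B 1 $$ (c, b))"
    by (rule index_mult_mat_sum) (use assms ab in auto)
  also have "\<dots> = (\<Sum>c<q. scale (A $$ (a, c) * B $$ (c, b)) 1)"
    using assms ab by (intro sum.cong) (auto simp: mat_tensor_def scale_one_mult)
  also have "\<dots> = scale ((A * B) $$ (a, b)) 1"
    unfolding index_mult_mat_sum[OF assms ab] by (rule scale_sum_left[symmetric])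
  finally show "(mat_tensor scale A 1 * mat_tensor scale B 1) $$ (a, b) = mat_tensor scale (A * B) 1 $$ (a, b)"
    using assms ab by (simp add: mat_tensor_def)
qed (use assms in \<open>auto simp: mat_tensor_def\<close>)

lemma alg_extend_index:
  assumes "\<And>i j. T (elem_mat s i j) \<in> carrier_mat p q" "a < p" "b < q"
  shows "alg_extend scale s p q T Z $$ (a, b) =
    (\<Sum>x\<in>{..<s} \<times> {..<s}. scale (T (elem_mat s (fst x) (snd x)) $$ (a, b)) (Z $$ x))"
proof -
  have "dim_row (T (elem_mat s i j)) = p" "dim_col (T (elem_mat s i j)) = q" for i j
    using assms(1)[of i j] by auto
  then show ?thesis using assms(2,3)
    by (auto simp: alg_extend_def mat_sum_def mat_tensor_def split_beta intro!: sum.cong)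
qed

lemma alg_extend_carrier [simp]: "alg_extend scale s p q T Z \<in> carrier_mat p q"
  by (simp add: alg_extend_def)

text \<open>\<open>alg_extend\<close> evaluates its map on matrix units only, so the relation
  between \<open>U\<close> and \<open>T\<close> is asked for just there. The scalar factor
  \<open>A\<close> then moves through the sum defining the extension.\<close>

lemma alg_extend_mult_left:
  assumes A: "A \<in> carrier_mat p q" and T: "\<And>i j. T (elem_mat s i j) \<in> carrier_mat q r"
    and U: "\<And>i j. U (elem_mat s i j) = A * T (elem_mat s i j)"
  shows "alg_extend scale s p r U Z = mat_tensor scale A 1 * alg_extend scale s q r T Z"
proof (rule eq_matI)
  let ?r = "mat_tensor scale A 1 * alg_extend scale s q r T Z"
  fix a b assume "a < dim_row ?r" "b < dim_col ?r"
  then have ab: "a < p" "b < r" using A by (auto simp: mat_tensor_def alg_extend_def mat_sum_def)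
  have Uc: "U (elem_mat s i j) \<in> carrier_mat p r" for i j using A T U by auto
  have "?r $$ (a, b) = (\<Sum>c<q. mat_tensor scale A 1 $$ (a, c) * alg_extend scale s q r T Z $$ (c, b))"
    by (rule index_mult_mat_sum) (use A ab in auto)
  also have "\<dots> = (\<Sum>c<q. \<Sum>x\<in>{..<s} \<times> {..<s}.
      scale (A $$ (a, c) * T (elem_mat s (fst x) (snd x)) $$ (c, b)) (Z $$ x))"
    using A ab by (intro sum.cong)
      (auto simp: alg_extend_index[of T s q r, OF T] sum_distrib_left scale_one_mult mat_tensor_def)
  also have "\<dots> = (\<Sum>x\<in>{..<s} \<times> {..<s}. scale (U (elem_mat s (fst x) (snd x)) $$ (a, b)) (Z $$ x))"
    unfolding U index_mult_mat_sum[OF A T ab] scale_sum_left by (rule sum.swap)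
  also have "\<dots> = alg_extend scale s p r U Z $$ (a, b)" by (rule alg_extend_index[where T = U, OF Uc ab, symmetric])
  finally show "alg_extend scale s p r U Z $$ (a, b) = ?r $$ (a, b)" by simp
qed (use A in \<open>auto simp: mat_tensor_def alg_extend_def mat_sum_def\<close>)

lemma alg_extend_mult_right:
  assumes A: "A \<in> carrier_mat q r" and T: "\<And>i j. T (elem_mat s i j) \<in> carrier_mat p q"
    and U: "\<And>i j. U (elem_mat s i j) = T (elem_mat s i j) * A"
  shows "alg_extend scale s p r U Z = alg_extend scale s p q T Z * mat_tensor scale A 1"
proof (rule eq_matI)
  let ?r = "alg_extend scale s p q T Z * mat_tensor scale A 1"
  fix a b assume "a < dim_row ?r" "b < dim_col ?r"
  then have ab: "a < p" "b < r" using A by (auto simp: mat_tensor_def alg_extend_def mat_sum_def)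
  have Uc: "U (elem_mat s i j) \<in> carrier_mat p r" for i j
    unfolding U by (rule mult_carrier_mat[OF T A])
  have "?r $$ (a, b) = (\<Sum>c<q. alg_extend scale s p q T Z $$ (a, c) * mat_tensor scale A 1 $$ (c, b))"
    by (rule index_mult_mat_sum) (use A ab in auto)
  also have "\<dots> = (\<Sum>c<q. \<Sum>x\<in>{..<s} \<times> {..<s}.
      scale (T (elem_mat s (fst x) (snd x)) $$ (a, c) * A $$ (c, b)) (Z $$ x))"
    using A ab by (intro sum.cong)
      (auto simp: alg_extend_index[of T s p q, OF T] sum_distrib_right scale_one_mult mat_tensor_def)
  also have "\<dots> = (\<Sum>x\<in>{..<s} \<times> {..<s}. scale (U (elem_mat s (fst x) (snd x)) $$ (a, b)) (Z $$ x))"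
    unfolding U index_mult_mat_sum[OF T A ab] scale_sum_left by (rule sum.swap)
  also have "\<dots> = alg_extend scale s p r U Z $$ (a, b)" by (rule alg_extend_index[where T = U, OF Uc ab, symmetric])
  finally show "alg_extend scale s p r U Z $$ (a, b) = ?r $$ (a, b)" by simp
qed (use A in \<open>auto simp: mat_tensor_def alg_extend_def mat_sum_def\<close>)

end

locale fm_similar_pair_alg = fm_similar_pair s F G T T' + unital_algebra scale
  for s :: nat and F G :: "('d::finite, 'k::field) fm" and T T' :: "'k mat"
    and scale :: "'k \<Rightarrow> 'a \<Rightarrow> 'a::{ring, monoid_mult}"
begin

lemma elem_mat_carrier [simp]: "elem_mat s i j \<in> carrier_mat s s"
  by (simp add: elem_mat_def)

lemma tensor_inv: "mat_tensor scale T 1 * mat_tensor scale T' 1 = 1\<^sub>m n"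
  "mat_tensor scale T' 1 * mat_tensor scale T 1 = 1\<^sub>m n"
  by (simp_all only: tensor_mult[OF T] tensor_mult[OF T(2,1)] inv tensor_one)

lemma alg_pencil_carrier: "fm_alg_pencil scale s Y F Z \<in> carrier_mat n n"
  unfolding fm_alg_pencil_def by (rule minus_carrier_mat) simp

lemma alg_pencil_conj:
  "fm_alg_pencil scale s Y G Z = mat_tensor scale T 1 * fm_alg_pencil scale s Y F Z * mat_tensor scale T' 1"
proof -
  let ?T = "mat_tensor scale T 1" and ?T' = "mat_tensor scale T' 1"
  let ?A = "\<lambda>F k. alg_extend scale s n n (fm_A F k) (Z k - mat_tensor scale (Y k) 1)"
  note Tc = tensor_carrier[OF T(1), of 1] tensor_carrier[OF T(2), of 1]
  have "?A G k = ?T * ?A F k * ?T'" for k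
  proof -
    let ?Z = "Z k - mat_tensor scale (Y k) 1"
    \<comment> \<open>The right factor \<open>T'\<close> is pulled out first, leaving the
      intermediate map with left factor \<open>T\<close> for the next step.\<close>
    have "?A G k = alg_extend scale s n n (\<lambda>X. T * fm_A F k X) ?Z * ?T'"
      by (rule alg_extend_mult_right[OF T(2)])
        (rule mult_carrier_mat[OF T(1) F.carriers(3)[OF elem_mat_carrier]], simp add: A_eq)
    also have "alg_extend scale s n n (\<lambda>X. T * fm_A F k X) ?Z = ?T * ?A F k"
      by (rule alg_extend_mult_left[OF T(1)]) auto
    finally show ?thesis .
  qed
  then have "mat_sum n n (?A G) UNIV = ?T * mat_sum n n (?A F) UNIV * ?T'"
    by (simp only: mat_sum_mult[OF mult_carrier_mat[OF Tc(1) alg_extend_carrier] Tc(2)]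
        mult_mat_sum[OF Tc(1) alg_extend_carrier])
  then show ?thesis
    unfolding fm_alg_pencil_def L_eq tensor_one
    by (simp only: one_minus_conj_mat[OF Tc mat_sum_carrier tensor_inv(1)])
qed

lemma alg_DOM_eq: "fm_alg_DOM scale s Y G = fm_alg_DOM scale s Y F"
  unfolding fm_alg_DOM_def alg_pencil_conj
    mat_inverse_conj_iff[OF alg_pencil_carrier tensor_carrier[OF T(1)] tensor_carrier[OF T(2)] tensor_inv] ..

lemma alg_eval_eq:
  assumes "Z \<in> fm_alg_DOM scale s Y F"
  shows "fm_alg_eval scale s Y G Z = fm_alg_eval scale s Y F Z"
proof -
  let ?B = "\<lambda>F k. alg_extend scale s n s (fm_B F k) (Z k - mat_tensor scale (Y k) 1)"
  note Tc = tensor_carrier[OF T(1), of 1] tensor_carrier[OF T(2), of 1]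
  have "?B G k = mat_tensor scale T 1 * ?B F k" for k
    by (rule alg_extend_mult_left[OF T(1)]) (simp_all add: B_eq)
  then have B: "mat_sum n s (?B G) UNIV = mat_tensor scale T 1 * mat_sum n s (?B F) UNIV"
    by (simp only: mult_mat_sum[OF Tc(1) alg_extend_carrier])
  have C: "mat_tensor scale (fm_C G) 1 = mat_tensor scale (fm_C F) 1 * mat_tensor scale T' 1"
    unfolding C_eq by (rule tensor_mult[OF F.carriers(2) T(2), symmetric])
  have "\<exists>Q. is_mat_inverse (fm_alg_pencil scale s Y F Z) Q" using assms by (simp add: fm_alg_DOM_def)
  note transfer = transfer_conj[OF alg_pencil_carrier Tc tensor_inv tensor_carrier[OF F.carriers(2)] mat_sum_carrier this]
  show ?thesis unfolding fm_alg_eval_def D_eq L_eq B C alg_pencil_conj transfer ..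
qed

end

theorem theorem2p13:
  fixes R1 R2 :: "('d::finite, 'k::field) nc_rat"
    and F1 F2 :: "('d, 'k) fm"
    and s :: nat
    and Y :: "'d \<Rightarrow> 'k mat"
  assumes "s \<ge> 1"
    and "\<And>k. Y k \<in> carrier_mat s s"
    and "fm_realization s F1"
    and "fm_realization s F2"
    and "admits_realization R1 s Y F1"
    and "admits_realization R2 s Y F2"
    and "fm_controllable s F1" and "fm_observable s F1"
    and "fm_controllable s F2" and "fm_observable s F2"
    and "nc_eval_equiv R1 R2"
  shows "uniquely_similar s F1 F2 \<and>
    (\<forall>m\<ge>1. fm_DOM s Y F1 m = fm_DOM s Y F2 m \<and>
       (\<forall>X\<in>fm_DOM s Y F1 m. fm_eval s Y F1 m X = fm_eval s Y F2 m X)) \<and>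
    (\<forall>scale :: 'k \<Rightarrow> 'a \<Rightarrow> ('a::{ring, monoid_mult}). unital_algebra scale \<longrightarrow>
       fm_alg_DOM scale s Y F1 = fm_alg_DOM scale s Y F2 \<and>
       (\<forall>Z\<in>fm_alg_DOM scale s Y F1. fm_alg_eval scale s Y F1 Z = fm_alg_eval scale s Y F2 Z))"
proof -
  note moments = moments_eq[OF assms(3,4,2,5,6,11,1)]
  interpret F: fm_pair s F1 F2
    by unfold_locales (use assms(3,4) moments(2) in auto)
  \<comment> \<open>The empty word and the zero matrix are arbitrary choices: every chain point
    shows \<open>D\<close> on its diagonal.\<close>
  have D: "fm_D F1 = fm_D F2" by (rule moments(1)[of "[]" "0\<^sub>m s s"]) auto
  note sim = F.unique_similarity[OF assms(7,9,8,10)]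
  then have us: "uniquely_similar s F1 F2" using D by (simp add: uniquely_similar_def)
  obtain T where T: "fm_similarity s F1 F2 T" using sim(2) by blast
  then obtain T' where T': "is_mat_inverse T T'"
    unfolding fm_similarity_def invertible_mat_iff_is_mat_inverse by blast
  interpret S: fm_similar_pair s F1 F2 T T'
    by unfold_locales
      (use T T' D sim(1) mat_inv_eqI[OF T'] in \<open>auto simp: fm_similarity_def is_mat_inverse_def\<close>)
  have "fm_alg_DOM scale s Y F1 = fm_alg_DOM scale s Y F2 \<and>
      (\<forall>Z\<in>fm_alg_DOM scale s Y F1. fm_alg_eval scale s Y F1 Z = fm_alg_eval scale s Y F2 Z)"
    if "unital_algebra scale" for scale :: "'k \<Rightarrow> 'a \<Rightarrow> ('a::{ring, monoid_mult})"
  proof -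
    interpret unital_algebra scale by (rule that)
    interpret A: fm_similar_pair_alg s F1 F2 T T' scale by unfold_locales
    show ?thesis using A.alg_DOM_eq A.alg_eval_eq by metis
  qed
  then show ?thesis using us S.DOM_eq S.eval_eq by metis
qed

end
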